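(* Let $n,c$ be positive integers. The number of irreducible components of $\mathrm{Hilb}^{[c]}(\mathbb{C}^n)$ is smaller than, or equal to, the number of irreducible components of $\mathcal{C}(n,c)$. In particular, if $\mathcal{C}(n,c)$ is irreducible, then $\mathrm{Hilb}^{[c]}(\mathbb{C}^n)$ is also irreducible.
   Context: $\mathrm{Hilb}^{[c]}(\mathbb{C}^n)$ is the Hilbert scheme parametrizing $0$-dimensional subschemes of $\mathbb{C}^n$ of length $c$. For a complex vector space $V$ of dimension $c$, $\mathcal{C}(n,c)=\{(B_0,\dots,B_{n-1})\in\mathrm{End}(V)^{\oplus n}\mid[B_i,B_j]=0\ \forall i\ne j\}$ is the variety of $n$ commuting $c\times c$ matrices. *)

theory Defs
  imports "HOL-Analysis.Analysis" "HOL-Library.Poly_Mapping" "HOL-Library.Equipollence"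
begin

section \<open>Polynomials and the Zariski topology\<close>

type_synonym 'v monomial = "'v \<Rightarrow>\<^sub>0 nat"

text \<open>The ring structure of \<open>('v \<Rightarrow>\<^sub>0 nat) \<Rightarrow>\<^sub>0 complex\<close> from \<open>HOL-Library.Poly_Mapping\<close>
  (convolution product) is that of \<open>\<complex>[x\<^sub>v | v :: 'v]\<close>.\<close>
type_synonym 'v cpoly = "'v monomial \<Rightarrow>\<^sub>0 complex"

definition eval_monomial :: "('v \<Rightarrow> complex) \<Rightarrow> 'v monomial \<Rightarrow> complex" where
  "eval_monomial x m = (\<Prod>v\<in>Poly_Mapping.keys m. x v ^ Poly_Mapping.lookup m v)"

definition eval_poly :: "('v \<Rightarrow> complex) \<Rightarrow> 'v cpoly \<Rightarrow> complex" where
  "eval_poly x p = (\<Sum>m\<in>Poly_Mapping.keys p. Poly_Mapping.lookup p m * eval_monomial x m)"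

definition zero_locus :: "'v cpoly set \<Rightarrow> ('v \<Rightarrow> complex) set" where
  "zero_locus P = {x. \<forall>p\<in>P. eval_poly x p = 0}"

text \<open>The index type \<open>'v\<close> may be infinite; every single polynomial involves finitely many
  coordinates only.\<close>
definition zariski :: "('v \<Rightarrow> complex) topology" where
  "zariski = topology (\<lambda>U. \<exists>P. U = - zero_locus P)"

lemma eval_monomial_superset:
  assumes "finite A" "Poly_Mapping.keys m \<subseteq> A"
  shows "eval_monomial x m = (\<Prod>v\<in>A. x v ^ Poly_Mapping.lookup m v)"
  unfolding eval_monomial_def
  by (rule prod.mono_neutral_left) (use assms in \<open>auto simp: in_keys_iff\<close>)

lemma eval_monomial_zero [simp]: "eval_monomial x 0 = 1"
  by (simp add: eval_monomial_def)

lemma eval_monomial_add: "eval_monomial x (m + k) = eval_monomial x m * eval_monomial x k"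
proof -
  let ?A = "Poly_Mapping.keys m \<union> Poly_Mapping.keys k"
  have "Poly_Mapping.keys (m + k) \<subseteq> ?A" by (rule Poly_Mapping.keys_add)
  then show ?thesis
    by (simp add: eval_monomial_superset[of ?A] lookup_add power_add prod.distrib)
qed

lemma eval_poly_superset:
  assumes "finite A" "Poly_Mapping.keys p \<subseteq> A"
  shows "eval_poly x p = (\<Sum>m\<in>A. Poly_Mapping.lookup p m * eval_monomial x m)"
  unfolding eval_poly_def
  by (rule sum.mono_neutral_left) (use assms in \<open>auto simp: in_keys_iff\<close>)

lemma eval_poly_zero [simp]: "eval_poly x 0 = 0"
  by (simp add: eval_poly_def)

lemma eval_poly_single [simp]:
  "eval_poly x (Poly_Mapping.single m a) = a * eval_monomial x m"
  by (simp add: eval_poly_def)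

lemma eval_poly_one [simp]: "eval_poly x 1 = 1"
  using eval_poly_single[of x 0 1] by simp

lemma eval_poly_add: "eval_poly x (p + q) = eval_poly x p + eval_poly x q"
proof -
  let ?A = "Poly_Mapping.keys p \<union> Poly_Mapping.keys q"
  have "Poly_Mapping.keys (p + q) \<subseteq> ?A" by (rule Poly_Mapping.keys_add)
  then show ?thesis
    by (simp add: eval_poly_superset[of ?A] lookup_add distrib_right sum.distrib)
qed

lemma eval_poly_sum: "eval_poly x (sum f A) = (\<Sum>a\<in>A. eval_poly x (f a))"
  by (induction A rule: infinite_finite_induct) (simp_all add: eval_poly_add)

lemma cpoly_as_sum:
  "p = (\<Sum>m\<in>Poly_Mapping.keys p. Poly_Mapping.single m (Poly_Mapping.lookup p m))"
proof (rule poly_mapping_eqI)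
  fix k
  show "Poly_Mapping.lookup p k =
    Poly_Mapping.lookup (\<Sum>m\<in>Poly_Mapping.keys p. Poly_Mapping.single m (Poly_Mapping.lookup p m)) k"
    by (auto simp: lookup_sum lookup_single when_def in_keys_iff)
qed

lemma eval_poly_mult: "eval_poly x (p * q) = eval_poly x p * eval_poly x q"
proof -
  have "p * q = (\<Sum>m\<in>Poly_Mapping.keys p. \<Sum>k\<in>Poly_Mapping.keys q.
      Poly_Mapping.single (m + k) (Poly_Mapping.lookup p m * Poly_Mapping.lookup q k))"
  proof -
    have "p * q =
        (\<Sum>m\<in>Poly_Mapping.keys p. Poly_Mapping.single m (Poly_Mapping.lookup p m)) *
        (\<Sum>k\<in>Poly_Mapping.keys q. Poly_Mapping.single k (Poly_Mapping.lookup q k))"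
      by (rule arg_cong2[where f = "(*)", OF cpoly_as_sum cpoly_as_sum])
    then show ?thesis
      by (simp only: sum_product mult_single)
  qed
  then have "eval_poly x (p * q) = (\<Sum>m\<in>Poly_Mapping.keys p. \<Sum>k\<in>Poly_Mapping.keys q.
      (Poly_Mapping.lookup p m * eval_monomial x m) * (Poly_Mapping.lookup q k * eval_monomial x k))"
    by (simp add: eval_poly_sum eval_monomial_add mult_ac)
  then show ?thesis
    by (simp add: eval_poly_def sum_product)
qed

lemma istopology_zariski: "istopology (\<lambda>U. \<exists>P. U = - zero_locus P)"
  unfolding istopology_def
proof (intro conjI allI impI)
  fix S T :: "('a \<Rightarrow> complex) set"
  assume "\<exists>P. S = - zero_locus P" "\<exists>P. T = - zero_locus P"
  then obtain P Q where PQ: "S = - zero_locus P" "T = - zero_locus Q" by blast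
  let ?R = "(\<lambda>(p, q). p * q) ` (P \<times> Q)"
  have "S \<inter> T = - zero_locus ?R"
  proof (rule set_eqI)
    fix x
    have "x \<in> S \<inter> T \<longleftrightarrow> (\<exists>p\<in>P. eval_poly x p \<noteq> 0) \<and> (\<exists>q\<in>Q. eval_poly x q \<noteq> 0)"
      by (simp add: PQ zero_locus_def)
    also have "\<dots> \<longleftrightarrow> (\<exists>p\<in>P. \<exists>q\<in>Q. eval_poly x (p * q) \<noteq> 0)"
      by (simp add: eval_poly_mult bex_simps)
    also have "\<dots> \<longleftrightarrow> x \<in> - zero_locus ?R"
      by (simp add: zero_locus_def)
    finally show "x \<in> S \<inter> T \<longleftrightarrow> x \<in> - zero_locus ?R" .
  qed
  then show "\<exists>P. S \<inter> T = - zero_locus P" by blast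
next
  fix K :: "('a \<Rightarrow> complex) set set"
  assume "\<forall>S\<in>K. \<exists>P. S = - zero_locus P"
  then obtain P where P: "\<And>S. S \<in> K \<Longrightarrow> S = - zero_locus (P S)" by metis
  have "\<Union>K = (\<Union>S\<in>K. - zero_locus (P S))" using P by auto
  also have "\<dots> = - zero_locus (\<Union>S\<in>K. P S)" by (auto simp: zero_locus_def)
  finally show "\<exists>P. \<Union>K = - zero_locus P" by blast
qed

lemma openin_zariski: "openin zariski U \<longleftrightarrow> (\<exists>P. U = - zero_locus P)"
  unfolding zariski_def topology_inverse'[OF istopology_zariski] ..

lemma topspace_zariski [simp]: "topspace zariski = UNIV"
proof -
  have "UNIV = - zero_locus {1}" by (auto simp: zero_locus_def)
  then have "openin zariski UNIV" unfolding openin_zariski by blast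
  then show ?thesis using openin_subset by blast
qed

lemma closedin_zariski: "closedin zariski Z \<longleftrightarrow> (\<exists>P. Z = zero_locus P)"
proof -
  have "UNIV - Z = - W \<longleftrightarrow> Z = W" for W :: "('a \<Rightarrow> complex) set"
    by blast
  then show ?thesis
    by (simp add: closedin_def openin_zariski)
qed


section \<open>Irreducible components\<close>

text \<open>The subspace topology is unfolded: \<open>S\<close> is non-empty and not covered by two closed sets
  neither of which contains it.\<close>
definition irreducible_in :: "'a topology \<Rightarrow> 'a set \<Rightarrow> bool" where
  "irreducible_in X S \<longleftrightarrow> S \<subseteq> topspace X \<and> S \<noteq> {} \<and>
     (\<forall>A B. closedin X A \<and> closedin X B \<and> S \<subseteq> A \<union> B \<longrightarrow> S \<subseteq> A \<or> S \<subseteq> B)"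

definition irreducible_space :: "'a topology \<Rightarrow> bool" where
  "irreducible_space X \<longleftrightarrow> irreducible_in X (topspace X)"

definition irreducible_components :: "'a topology \<Rightarrow> 'a set set" where
  "irreducible_components X =
     {S. irreducible_in X S \<and> (\<forall>T. irreducible_in X T \<and> S \<subseteq> T \<longrightarrow> T = S)}"


section \<open>The variety of commuting matrices\<close>

text \<open>With \<open>n = CARD('n)\<close> and \<open>c = CARD('c)\<close>; \<open>End(V)\<^sup>n\<close> is identified with the affine space
  of all matrix entries.\<close>

definition commuting_tuples :: "(complex^'c^'c)^'n \<Rightarrow> bool" where
  "commuting_tuples B \<longleftrightarrow> (\<forall>i j. i \<noteq> j \<longrightarrow> B $ i ** B $ j = B $ j ** B $ i)"

definition matrix_entries :: "(complex^'c^'c)^'n \<Rightarrow> 'n \<times> 'c \<times> 'c \<Rightarrow> complex" where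
  "matrix_entries B = (\<lambda>(i, j, k). B $ i $ j $ k)"

definition commuting_variety :: "((complex^'c^'c)^'n) topology" where
  "commuting_variety = pullback_topology {B. commuting_tuples B} matrix_entries zariski"

lemma topspace_commuting_variety: "topspace commuting_variety = {B. commuting_tuples B}"
  by (simp add: commuting_variety_def topspace_pullback_topology)


section \<open>The Hilbert scheme of points of affine space\<close>

text \<open>A closed subscheme of \<open>\<complex>\<^sup>n\<close> is an ideal of \<open>\<complex>[x\<^sub>1,\<dots>,x\<^sub>n]\<close>; it is \<open>0\<close>-dimensional of
  length \<open>c\<close> iff the coordinate ring, i.e. the quotient by the ideal, has complex dimension \<open>c\<close>.\<close>

definition is_ideal :: "'a::comm_ring_1 set \<Rightarrow> bool" where
  "is_ideal I \<longleftrightarrow> module.subspace (*) I"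

lemma is_ideal_iff:
  "is_ideal I \<longleftrightarrow> 0 \<in> I \<and> (\<forall>p\<in>I. \<forall>q\<in>I. p + q \<in> I) \<and> (\<forall>r. \<forall>p\<in>I. r * p \<in> I)"
proof -
  interpret module "(*) :: 'a \<Rightarrow> 'a \<Rightarrow> 'a"
    by standard (simp_all add: algebra_simps)
  show ?thesis unfolding is_ideal_def subspace_def by blast
qed

text \<open>The expansion of \<open>p\<close> modulo \<open>I\<close> as a complex linear combination of \<open>B\<close>.\<close>
definition expands_mod ::
    "'n cpoly set \<Rightarrow> 'n cpoly set \<Rightarrow> 'n cpoly \<Rightarrow> ('n cpoly \<Rightarrow> complex) \<Rightarrow> bool" where
  "expands_mod I B p a \<longleftrightarrow>
     (\<forall>b. b \<notin> B \<longrightarrow> a b = 0) \<and> p - (\<Sum>b\<in>B. Poly_Mapping.single 0 (a b) * b) \<in> I"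

text \<open>The residue classes of the elements of \<open>B\<close> are pairwise distinct and form a (finite)
  basis of the complex vector space \<open>\<complex>[x\<^sub>1,\<dots>,x\<^sub>n]/I\<close>.\<close>
definition quotient_basis :: "'n cpoly set \<Rightarrow> 'n cpoly set \<Rightarrow> bool" where
  "quotient_basis I B \<longleftrightarrow> finite B \<and> (\<forall>p. \<exists>!a. expands_mod I B p a)"

definition quotient_coords ::
    "'n cpoly set \<Rightarrow> 'n cpoly set \<Rightarrow> 'n cpoly \<Rightarrow> 'n cpoly \<Rightarrow> complex" where
  "quotient_coords I B p = (THE a. expands_mod I B p a)"

definition hilb_points :: "nat \<Rightarrow> 'n cpoly set set" where
  "hilb_points c = {I. is_ideal I \<and> (\<exists>B. quotient_basis I B \<and> card B = c)}"

definition monomial_poly :: "'n monomial \<Rightarrow> 'n cpoly" where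
  "monomial_poly m = Poly_Mapping.single m 1"

text \<open>The Hilbert scheme is glued from affine charts, one for each set \<open>M\<close> of \<open>c\<close> monomials:
  the chart consists of the ideals \<open>I\<close> modulo which \<open>M\<close> is a basis of the quotient. Its affine
  coordinates \<open>c\<^bsub>m,b\<^esub>\<close> (\<open>b \<in> M\<close>, \<open>m\<close> any monomial) are the coefficients in
  \<open>m \<equiv> (\<Sum>b\<in>M. c\<^bsub>m,b\<^esub> b) mod I\<close>; all but finitely many of them are polynomials in the remaining
  ones, so allowing all of them does not change the topology. These are the traces of the
  standard charts of the Grassmannian of rank \<open>c\<close> quotients of the polynomial ring. (Restricting
  to order ideals \<open>M\<close>, as is often done, gives a subcover of the same open cover, and hence the
  same topology.)\<close>

definition hilb_chart :: "'n monomial set \<Rightarrow> 'n cpoly set set" where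
  "hilb_chart M = {I. is_ideal I \<and> quotient_basis I (monomial_poly ` M)}"

definition chart_coords ::
    "'n monomial set \<Rightarrow> 'n cpoly set \<Rightarrow> 'n monomial \<times> 'n monomial \<Rightarrow> complex" where
  "chart_coords M I = (\<lambda>(m, b). quotient_coords I (monomial_poly ` M) (monomial_poly m) (monomial_poly b))"

definition chart_topology :: "'n monomial set \<Rightarrow> 'n cpoly set topology" where
  "chart_topology M = pullback_topology (hilb_chart M) (chart_coords M) zariski"

text \<open>The space of closed points of the Hilbert scheme with the Zariski topology. The scheme is
  of finite type over \<open>\<complex>\<close>, so intersecting with the set of closed points is an
  inclusion-preserving bijection on irreducible closed subsets, and hence on irreducible
  components; nilpotents play no role.\<close>
definition hilbert_scheme :: "nat \<Rightarrow> 'n cpoly set topology" where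
  "hilbert_scheme c = topology (\<lambda>U. U \<subseteq> hilb_points c \<and>
     (\<forall>M. finite M \<and> card M = c \<longrightarrow> openin (chart_topology M) (U \<inter> hilb_chart M)))"

lemma topspace_chart_topology [simp]: "topspace (chart_topology M) = hilb_chart M"
  by (simp add: chart_topology_def topspace_pullback_topology)

lemma istopology_hilbert_scheme:
  "istopology (\<lambda>U. U \<subseteq> hilb_points c \<and>
     (\<forall>M. finite M \<and> card M = c \<longrightarrow> openin (chart_topology M) (U \<inter> hilb_chart M)))"
  unfolding istopology_def
proof (intro conjI allI impI)
  fix S T :: "'a cpoly set set" and M :: "'a monomial set"
  assume S: "S \<subseteq> hilb_points c \<and> (\<forall>M. finite M \<and> card M = c \<longrightarrow>
      openin (chart_topology M) (S \<inter> hilb_chart M))"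
    and T: "T \<subseteq> hilb_points c \<and> (\<forall>M. finite M \<and> card M = c \<longrightarrow>
      openin (chart_topology M) (T \<inter> hilb_chart M))"
  show "S \<inter> T \<subseteq> hilb_points c" using S by blast
  assume "finite M \<and> card M = c"
  then have "openin (chart_topology M) ((S \<inter> hilb_chart M) \<inter> (T \<inter> hilb_chart M))"
    using S T by (metis openin_Int)
  moreover have "(S \<inter> hilb_chart M) \<inter> (T \<inter> hilb_chart M) = S \<inter> T \<inter> hilb_chart M"
    by blast
  ultimately show "openin (chart_topology M) (S \<inter> T \<inter> hilb_chart M)"
    by (simp only:)
next
  fix K :: "'a cpoly set set set" and M :: "'a monomial set"
  assume K: "\<forall>S\<in>K. S \<subseteq> hilb_points c \<and> (\<forall>M. finite M \<and> card M = c \<longrightarrow>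
      openin (chart_topology M) (S \<inter> hilb_chart M))"
  then show "\<Union>K \<subseteq> hilb_points c" by blast
  assume "finite M \<and> card M = c"
  then have "openin (chart_topology M) (\<Union>S\<in>K. S \<inter> hilb_chart M)"
    using K by (intro openin_Union) fast
  moreover have "(\<Union>S\<in>K. S \<inter> hilb_chart M) = \<Union>K \<inter> hilb_chart M"
    by blast
  ultimately show "openin (chart_topology M) (\<Union>K \<inter> hilb_chart M)"
    by (simp only:)
qed

lemma openin_hilbert_scheme:
  "openin (hilbert_scheme c) U \<longleftrightarrow> U \<subseteq> hilb_points c \<and>
     (\<forall>M. finite M \<and> card M = c \<longrightarrow> openin (chart_topology M) (U \<inter> hilb_chart M))"
  unfolding hilbert_scheme_def topology_inverse'[OF istopology_hilbert_scheme] ..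

lemma inj_monomial_poly: "inj monomial_poly"
proof (rule injI)
  fix m k :: "'a monomial"
  assume "monomial_poly m = monomial_poly k"
  then have "Poly_Mapping.keys (monomial_poly m) = Poly_Mapping.keys (monomial_poly k)"
    by (rule arg_cong)
  then show "m = k"
    by (simp add: monomial_poly_def)
qed

lemma hilb_chart_subset:
  assumes "finite M" "card M = c"
  shows "hilb_chart M \<subseteq> hilb_points c"
proof -
  have "card (monomial_poly ` M) = c"
    using assms card_image[OF inj_on_subset[OF inj_monomial_poly subset_UNIV, of M]] by simp
  then show ?thesis
    unfolding hilb_chart_def hilb_points_def by blast
qed

lemma topspace_hilbert_scheme: "topspace (hilbert_scheme c) = hilb_points c"
proof -
  have "openin (chart_topology M) (hilb_points c \<inter> hilb_chart M)"
    if "finite M" "card M = c" for M :: "'a monomial set"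
    using hilb_chart_subset[OF that] openin_topspace[of "chart_topology M"]
    by (simp add: Int_absorb1)
  then have "openin (hilbert_scheme c) (hilb_points c :: 'a cpoly set set)"
    unfolding openin_hilbert_scheme by blast
  moreover have "topspace (hilbert_scheme c) \<subseteq> (hilb_points c :: 'a cpoly set set)"
    using openin_topspace[of "hilbert_scheme c :: 'a cpoly set topology"]
    unfolding openin_hilbert_scheme by blast
  ultimately show ?thesis
    using openin_subset by blast
qed

end

theory Submission
  imports Defs
begin

text \<open>
  The usual argument presents the Hilbert scheme as the quotient by \<open>GL(V)\<close> of the space of pairs
  \<open>(B, v)\<close> in which \<open>B\<close> is a commuting tuple and \<open>v\<close> a cyclic vector for \<open>B\<close>; such a pair
  corresponds to the ideal \<open>{p. p(B) v = 0}\<close>. In fact this ideal depends on \<open>B\<close> alone: if \<open>v\<close> is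
  cyclic and \<open>p(B) v = 0\<close>, then \<open>p(B) q(B) v = q(B) p(B) v = 0\<close> for every \<open>q\<close>, so \<open>p(B) = 0\<close>.
  Hence it is the annihilator \<open>{p. p(B) = 0}\<close>, and there is a map \<open>B \<mapsto> annihilator B\<close> from
  the set of tuples that admit a cyclic vector (\<open>cyclic_tuples\<close>) to the Hilbert scheme.

  This map is defined on an open subset of the commuting variety and is continuous: around a given
  tuple a cyclic vector \<open>v\<close> can be kept fixed, and then Cramer's rule expresses the chart coordinates
  of the annihilator as rational functions of the matrix entries
  (\<open>openin_annihilator_in_chart\<close>). It also has a continuous section over every chart: an ideal for
  which the monomials in \<open>M\<close> form a basis of the quotient is sent to the matrices of multiplication
  by the variables in this basis. Their entries are chart coordinates, and their annihilator is
  the ideal one started with (\<open>annihilator_multiplication_matrices\<close>).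

  The rest is topology (\<open>irreducible_components_lepoll_of_local_sections\<close>). Let \<open>f\<close> be a continuous
  map from an open set \<open>A \<subseteq> X\<close> to \<open>Y\<close> that has local sections. Given a component \<open>Z\<close> of \<open>Y\<close>, apply a
  section to a non-empty open part of \<open>Z\<close>. The result is irreducible, so it lies in a component \<open>W\<close>
  of \<open>X\<close>. Now \<open>f(W \<inter> A)\<close> is irreducible and contains a dense part of \<open>Z\<close>, so its closure is \<open>Z\<close> by
  maximality. Thus \<open>W\<close> determines \<open>Z\<close>.

  The statement about irreducible spaces follows since an open part of an irreducible commuting
  variety maps onto the Hilbert scheme; the latter is non-empty because it
  contains every set of \<open>c\<close> distinct points (\<open>hilb_points_nonempty\<close>).
\<close>

section \<open>Irreducible components and maps with local sections\<close>

text \<open>Taking complements turns the definition by closed sets into a condition on open sets, which passes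
  easily to open subsets, to images and to unions of chains.\<close>
lemma irreducible_in_iff_open:
  "irreducible_in X S \<longleftrightarrow> S \<subseteq> topspace X \<and> S \<noteq> {} \<and>
     (\<forall>U V. openin X U \<and> openin X V \<and> S \<inter> U \<noteq> {} \<and> S \<inter> V \<noteq> {} \<longrightarrow> S \<inter> U \<inter> V \<noteq> {})"
proof (cases "S \<subseteq> topspace X")
  case True
  have "(\<forall>A B. closedin X A \<and> closedin X B \<and> S \<subseteq> A \<union> B \<longrightarrow> S \<subseteq> A \<or> S \<subseteq> B) \<longleftrightarrow>
     (\<forall>U V. openin X U \<and> openin X V \<and> S \<inter> U \<noteq> {} \<and> S \<inter> V \<noteq> {} \<longrightarrow> S \<inter> U \<inter> V \<noteq> {})"
    (is "?L \<longleftrightarrow> ?R")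
  proof
    assume L: ?L
    show ?R
    proof (intro allI impI notI)
      fix U V
      assume UV: "openin X U \<and> openin X V \<and> S \<inter> U \<noteq> {} \<and> S \<inter> V \<noteq> {}" and "S \<inter> U \<inter> V = {}"
      then have "S \<subseteq> (topspace X - U) \<union> (topspace X - V)"
        using True by blast
      moreover have "closedin X (topspace X - U)" "closedin X (topspace X - V)"
        using UV by auto
      ultimately have "S \<subseteq> topspace X - U \<or> S \<subseteq> topspace X - V"
        using L by blast
      then show False using UV by blast
    qed
  next
    assume R: ?R
    show ?L
    proof (intro allI impI)
      fix A B
      assume AB: "closedin X A \<and> closedin X B \<and> S \<subseteq> A \<union> B"
      then have "openin X (topspace X - A)" "openin X (topspace X - B)"
        by auto
      moreover have "S \<inter> (topspace X - A) \<inter> (topspace X - B) = {}"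
        using AB by blast
      ultimately have "S \<inter> (topspace X - A) = {} \<or> S \<inter> (topspace X - B) = {}"
        using R by meson
      then show "S \<subseteq> A \<or> S \<subseteq> B" using True by blast
    qed
  qed
  then show ?thesis by (simp add: irreducible_in_def)
qed (simp add: irreducible_in_def)

lemma irreducible_in_Int_open:
  assumes "irreducible_in X S" "openin X U" "S \<inter> U \<noteq> {}"
  shows "irreducible_in X (S \<inter> U)"
  unfolding irreducible_in_iff_open
proof (intro conjI allI impI)
  show "S \<inter> U \<subseteq> topspace X" "S \<inter> U \<noteq> {}"
    using assms by (auto simp: irreducible_in_def)
  fix V W
  assume VW: "openin X V \<and> openin X W \<and> S \<inter> U \<inter> V \<noteq> {} \<and> S \<inter> U \<inter> W \<noteq> {}"
  then have "openin X (U \<inter> V)" "openin X (U \<inter> W)"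
    using assms(2) by auto
  moreover have "S \<inter> (U \<inter> V) \<noteq> {}" "S \<inter> (U \<inter> W) \<noteq> {}"
    using VW by (auto simp: Int_assoc)
  ultimately have "S \<inter> (U \<inter> V) \<inter> (U \<inter> W) \<noteq> {}"
    using assms(1) unfolding irreducible_in_iff_open by blast
  then show "S \<inter> U \<inter> V \<inter> W \<noteq> {}" by blast
qed

lemma irreducible_in_subset_closure_Int_open:
  assumes "irreducible_in X S" "openin X U" "S \<inter> U \<noteq> {}"
  shows "S \<subseteq> X closure_of (S \<inter> U)"
  using assms unfolding irreducible_in_iff_open in_closure_of subset_iff
  by (smt (verit) IntI Int_iff disjoint_iff)

lemma irreducible_in_closure_of:
  assumes "irreducible_in X S"
  shows "irreducible_in X (X closure_of S)"
proof -
  have "S \<subseteq> X closure_of S"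
    using assms by (simp add: closure_of_subset irreducible_in_def)
  moreover have "X closure_of S \<subseteq> A" if "closedin X A" "S \<subseteq> A" for A
    using that by (simp add: closure_of_minimal)
  ultimately show ?thesis
    using assms closure_of_subset_topspace unfolding irreducible_in_def
    by (metis dual_order.trans subset_empty)
qed

text \<open>The map needs to be defined and continuous only on an open set \<open>A\<close> that contains \<open>S\<close>, since
  openness of preimages in \<open>A\<close> is then the same as openness in \<open>X\<close>.\<close>
lemma irreducible_in_continuous_image:
  assumes S: "irreducible_in X S" "S \<subseteq> A" and A: "openin X A"
    and f: "continuous_map (subtopology X A) Y f"
  shows "irreducible_in Y (f ` S)"
  unfolding irreducible_in_iff_open
proof (intro conjI allI impI)
  have top: "topspace (subtopology X A) = A"
    using openin_subset[OF A] by (simp add: Int_absorb1)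
  show "f ` S \<subseteq> topspace Y" "f ` S \<noteq> {}"
    using S f top by (auto simp: continuous_map_def irreducible_in_def)
  fix U V
  assume UV: "openin Y U \<and> openin Y V \<and> f ` S \<inter> U \<noteq> {} \<and> f ` S \<inter> V \<noteq> {}"
  have pre: "openin X {x \<in> A. f x \<in> W}" if "openin Y W" for W
    using openin_continuous_map_preimage[OF f that] A
    unfolding top by (simp add: openin_open_subtopology)
  have "S \<inter> {x \<in> A. f x \<in> U} \<noteq> {}" "S \<inter> {x \<in> A. f x \<in> V} \<noteq> {}"
    using UV S(2) by auto
  then have "S \<inter> {x \<in> A. f x \<in> U} \<inter> {x \<in> A. f x \<in> V} \<noteq> {}"
    using S(1) pre UV unfolding irreducible_in_iff_open by meson
  then show "f ` S \<inter> U \<inter> V \<noteq> {}" by blast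
qed

text \<open>Zorn's lemma: if two open sets meet the union of a chain, then both of them meet a single
  member of the chain, so unions of chains of irreducible sets are irreducible.\<close>
lemma irreducible_in_subset_component:
  assumes "irreducible_in X S"
  obtains T where "T \<in> irreducible_components X" "S \<subseteq> T"
proof -
  let ?F = "{T. irreducible_in X T \<and> S \<subseteq> T}"
  have "\<exists>M\<in>?F. \<forall>T\<in>?F. M \<subseteq> T \<longrightarrow> T = M"
  proof (rule subset_Zorn_nonempty)
    show "?F \<noteq> {}" using assms by blast
    fix \<C> assume ne: "\<C> \<noteq> {}" and chain: "subset.chain ?F \<C>"
    have "irreducible_in X (\<Union>\<C>)"
      unfolding irreducible_in_iff_open
    proof (intro conjI allI impI)
      have \<C>: "\<C> \<subseteq> ?F" using chain by (simp add: subset.chain_def)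
      show "\<Union>\<C> \<subseteq> topspace X" "\<Union>\<C> \<noteq> {}"
        using \<C> ne by (force simp: irreducible_in_def)+
      fix U V
      assume UV: "openin X U \<and> openin X V \<and> \<Union>\<C> \<inter> U \<noteq> {} \<and> \<Union>\<C> \<inter> V \<noteq> {}"
      then obtain T1 T2 where T: "T1 \<in> \<C>" "T2 \<in> \<C>" "T1 \<inter> U \<noteq> {}" "T2 \<inter> V \<noteq> {}"
        by blast
      then have "T1 \<subseteq> T2 \<or> T2 \<subseteq> T1"
        using chain unfolding subset_chain_def by blast
      then obtain T0 where T0: "T0 \<in> \<C>" "T0 \<inter> U \<noteq> {}" "T0 \<inter> V \<noteq> {}"
        using T by blast
      then have "irreducible_in X T0" using \<C> by blast
      then have "T0 \<inter> U \<inter> V \<noteq> {}"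
        using UV T0 unfolding irreducible_in_iff_open by blast
      then show "\<Union>\<C> \<inter> U \<inter> V \<noteq> {}" using T0 by blast
    qed
    moreover have "S \<subseteq> \<Union>\<C>"
      using ne chain unfolding subset_chain_def by blast
    ultimately show "\<Union>\<C> \<in> ?F" by blast
  qed
  then obtain M where M: "irreducible_in X M" "S \<subseteq> M"
    and max: "\<forall>T. irreducible_in X T \<and> S \<subseteq> T \<and> M \<subseteq> T \<longrightarrow> T = M"
    by blast
  then have "M \<in> irreducible_components X"
    unfolding irreducible_components_def by blast
  then show thesis using M that by blast
qed

text \<open>Every component of \<open>Y\<close> is the closure of \<open>f (W \<inter> A)\<close> for some component \<open>W\<close> of \<open>X\<close>, so
  \<open>W \<mapsto> closure of f (W \<inter> A)\<close> covers all components of \<open>Y\<close>. Such a \<open>W\<close> is found by moving an open part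
  of the given component of \<open>Y\<close> into \<open>X\<close> by a section.\<close>
lemma irreducible_components_lepoll_of_local_sections:
  assumes A: "openin X A" and f: "continuous_map (subtopology X A) Y f"
    and sections: "\<And>y. y \<in> topspace Y \<Longrightarrow> \<exists>V s. openin Y V \<and> y \<in> V \<and>
        continuous_map (subtopology Y V) X s \<and> (\<forall>z\<in>V. s z \<in> A \<and> f (s z) = z)"
  shows "irreducible_components Y \<lesssim> irreducible_components X"
proof -
  define G where "G = (\<lambda>W. Y closure_of (f ` (W \<inter> A)))"
  have "Z \<in> G ` irreducible_components X" if Z: "Z \<in> irreducible_components Y" for Z
  proof -
    have irrZ: "irreducible_in Y Z" and maxZ: "\<And>T. irreducible_in Y T \<Longrightarrow> Z \<subseteq> T \<Longrightarrow> T = Z"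
      using Z unfolding irreducible_components_def by blast+
    then obtain y where y: "y \<in> Z" "y \<in> topspace Y"
      unfolding irreducible_in_def by blast
    then obtain V s where V: "openin Y V" "y \<in> V"
      and s: "continuous_map (subtopology Y V) X s" "\<And>z. z \<in> V \<Longrightarrow> s z \<in> A \<and> f (s z) = z"
      using sections by meson
    have "Z \<inter> V \<noteq> {}" using y V by blast
    then have "irreducible_in Y (Z \<inter> V)"
      using irrZ V irreducible_in_Int_open by blast
    then have "irreducible_in X (s ` (Z \<inter> V))"
      using V s irreducible_in_continuous_image by blast
    then obtain W where W: "W \<in> irreducible_components X" "s ` (Z \<inter> V) \<subseteq> W"
      by (rule irreducible_in_subset_component)
    have "s y \<in> W \<inter> A" using W y V s by blast
    then have "W \<inter> A \<noteq> {}" by blast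
    moreover have "irreducible_in X W"
      using W unfolding irreducible_components_def by blast
    ultimately have "irreducible_in X (W \<inter> A)"
      by (simp add: A irreducible_in_Int_open)
    then have irr: "irreducible_in Y (G W)"
      unfolding G_def using A f
      by (intro irreducible_in_closure_of irreducible_in_continuous_image[OF _ _ A f]) auto
    have "Z \<inter> V \<subseteq> f ` (W \<inter> A)"
    proof
      fix z assume "z \<in> Z \<inter> V"
      then have "s z \<in> W \<inter> A" "f (s z) = z" using W s by auto
      then show "z \<in> f ` (W \<inter> A)" by force
    qed
    then have "Y closure_of (Z \<inter> V) \<subseteq> G W"
      unfolding G_def by (rule closure_of_mono)
    then have "Z \<subseteq> G W"
      using irreducible_in_subset_closure_Int_open[OF irrZ V(1) \<open>Z \<inter> V \<noteq> {}\<close>] by blast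
    then have "G W = Z" using irr maxZ by blast
    then show ?thesis using W by blast
  qed
  then have "irreducible_components Y \<subseteq> G ` irreducible_components X" by blast
  then show ?thesis
    using subset_image_lepoll by blast
qed

lemma irreducible_space_continuous_image:
  assumes "irreducible_space X" "openin X A" "continuous_map (subtopology X A) Y f"
    and "f ` A = topspace Y" "topspace Y \<noteq> {}"
  shows "irreducible_space Y"
proof -
  have "A \<noteq> {}" using assms(4,5) by blast
  moreover have "topspace X \<inter> A = A"
    using openin_subset[OF assms(2)] by blast
  ultimately have "topspace X \<inter> A = A" "topspace X \<inter> A \<noteq> {}" by simp_all
  then have "irreducible_in X A"
    using assms(1,2) irreducible_in_Int_open[of X "topspace X" A]
    unfolding irreducible_space_def by simp
  then show ?thesis
    using irreducible_in_continuous_image[OF _ _ assms(2,3)] assms(4)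
    unfolding irreducible_space_def by force
qed

section \<open>Polynomial functions with a common denominator\<close>

text \<open>The functions on \<open>S\<close> that are polynomials in the coordinates \<open>e\<close> divided by a power of the
  polynomial \<open>d\<close>. The denominator is cleared, so that closure under sums and products holds without
  assuming that \<open>d\<close> has no zeros on \<open>S\<close>; the case \<open>d = 1\<close> is that of polynomial functions.\<close>
definition fraction_on ::
    "('a \<Rightarrow> 'v \<Rightarrow> complex) \<Rightarrow> 'a set \<Rightarrow> 'v cpoly \<Rightarrow> ('a \<Rightarrow> complex) \<Rightarrow> bool" where
  "fraction_on e S d f \<longleftrightarrow>
     (\<exists>q k. \<forall>x\<in>S. f x * eval_poly (e x) d ^ k = eval_poly (e x) q)"

lemma eval_poly_power: "eval_poly x (p ^ k) = eval_poly x p ^ k"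
  by (induction k) (simp_all add: eval_poly_mult)

lemma fraction_on_const: "fraction_on e S d (\<lambda>_. a)"
  unfolding fraction_on_def
  by (rule exI[of _ "Poly_Mapping.single 0 a"], rule exI[of _ 0]) simp

lemma fraction_on_coordinate: "fraction_on e S d (\<lambda>x. e x v)"
  unfolding fraction_on_def
  by (rule exI[of _ "Poly_Mapping.single (Poly_Mapping.single v 1) 1"], rule exI[of _ 0])
     (simp add: eval_monomial_def)

lemma fraction_on_add:
  assumes "fraction_on e S d f" "fraction_on e S d g"
  shows "fraction_on e S d (\<lambda>x. f x + g x)"
proof -
  obtain p k where f: "\<And>x. x \<in> S \<Longrightarrow> f x * eval_poly (e x) d ^ k = eval_poly (e x) p"
    using assms(1) unfolding fraction_on_def by blast
  obtain q l where g: "\<And>x. x \<in> S \<Longrightarrow> g x * eval_poly (e x) d ^ l = eval_poly (e x) q"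
    using assms(2) unfolding fraction_on_def by blast
  have "(f x + g x) * eval_poly (e x) d ^ (k + l) = eval_poly (e x) (p * d ^ l + q * d ^ k)"
    if "x \<in> S" for x
    unfolding eval_poly_add eval_poly_mult eval_poly_power f[OF that, symmetric] g[OF that, symmetric]
    by (simp add: power_add algebra_simps)
  then show ?thesis unfolding fraction_on_def by blast
qed

lemma fraction_on_mult:
  assumes "fraction_on e S d f" "fraction_on e S d g"
  shows "fraction_on e S d (\<lambda>x. f x * g x)"
proof -
  obtain p k where f: "\<And>x. x \<in> S \<Longrightarrow> f x * eval_poly (e x) d ^ k = eval_poly (e x) p"
    using assms(1) unfolding fraction_on_def by blast
  obtain q l where g: "\<And>x. x \<in> S \<Longrightarrow> g x * eval_poly (e x) d ^ l = eval_poly (e x) q"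
    using assms(2) unfolding fraction_on_def by blast
  have "(f x * g x) * eval_poly (e x) d ^ (k + l) = eval_poly (e x) (p * q)"
    if "x \<in> S" for x
    unfolding eval_poly_mult f[OF that, symmetric] g[OF that, symmetric]
    by (simp add: power_add algebra_simps)
  then show ?thesis unfolding fraction_on_def by blast
qed

lemma fraction_on_sum:
  assumes "\<And>i. i \<in> A \<Longrightarrow> fraction_on e S d (f i)"
  shows "fraction_on e S d (\<lambda>x. \<Sum>i\<in>A. f i x)"
  using assms
  by (induction A rule: infinite_finite_induct) (simp_all add: fraction_on_const fraction_on_add)

lemma fraction_on_prod:
  assumes "\<And>i. i \<in> A \<Longrightarrow> fraction_on e S d (f i)"
  shows "fraction_on e S d (\<lambda>x. \<Prod>i\<in>A. f i x)"
  using assms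
  by (induction A rule: infinite_finite_induct) (simp_all add: fraction_on_const fraction_on_mult)

lemma fraction_on_power:
  assumes "fraction_on e S d f"
  shows "fraction_on e S d (\<lambda>x. f x ^ k)"
  by (induction k) (simp_all add: fraction_on_const fraction_on_mult assms)

lemma fraction_on_eval_poly:
  assumes "\<And>v. fraction_on e S d (\<lambda>x. F x v)"
  shows "fraction_on e S d (\<lambda>x. eval_poly (F x) p)"
  unfolding eval_poly_def eval_monomial_def
  by (intro fraction_on_sum fraction_on_mult fraction_on_prod fraction_on_power
      fraction_on_const assms)

lemma fraction_on_det:
  fixes F :: "'a \<Rightarrow> complex^'c^'c"
  assumes "\<And>i j. fraction_on e S d (\<lambda>x. F x $ i $ j)"
  shows "fraction_on e S d (\<lambda>x. det (F x))"
  unfolding det_def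
  by (intro fraction_on_sum fraction_on_mult fraction_on_prod fraction_on_const assms)

lemma fraction_on_cong:
  assumes "fraction_on e S d f" "\<And>x. x \<in> S \<Longrightarrow> f x = g x"
  shows "fraction_on e S d g"
  using assms unfolding fraction_on_def by (metis (no_types, lifting))

lemma fraction_on_1D:
  assumes "fraction_on e S 1 f"
  obtains q where "\<And>x. x \<in> S \<Longrightarrow> f x = eval_poly (e x) q"
  using assms unfolding fraction_on_def by auto

lemma fraction_on_divide:
  assumes "fraction_on e S 1 f" "\<And>x. x \<in> T \<Longrightarrow> eval_poly (e x) d \<noteq> 0" "T \<subseteq> S"
  shows "fraction_on e T d (\<lambda>x. f x / eval_poly (e x) d)"
proof -
  obtain q where "\<And>x. x \<in> S \<Longrightarrow> f x = eval_poly (e x) q"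
    using assms(1) by (rule fraction_on_1D) blast
  then have "\<forall>x\<in>T. f x / eval_poly (e x) d * eval_poly (e x) d ^ 1 = eval_poly (e x) q"
    using assms by auto
  then show ?thesis unfolding fraction_on_def by blast
qed

lemma openin_pullback_zariski:
  "openin (pullback_topology S e zariski) U \<longleftrightarrow>
     (\<exists>P. U = {x \<in> S. \<exists>p\<in>P. eval_poly (e x) p \<noteq> 0})"
proof -
  have "e -` (- zero_locus P) \<inter> S = {x \<in> S. \<exists>p\<in>P. eval_poly (e x) p \<noteq> 0}" for P
    by (auto simp: zero_locus_def)
  then show ?thesis
    unfolding openin_pullback_topology openin_zariski by (metis (no_types, lifting))
qed

text \<open>Where \<open>d\<close> does not vanish, a fraction is non-zero iff its numerator is, and the numerator is a
  polynomial.\<close>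
lemma openin_nonvanishing_fractions:
  assumes "\<And>f. f \<in> K \<Longrightarrow> fraction_on e {x \<in> S. eval_poly (e x) d \<noteq> 0} d f"
  shows "openin (pullback_topology S e zariski)
    {x \<in> S. eval_poly (e x) d \<noteq> 0 \<and> (\<exists>f\<in>K. f x \<noteq> 0)}"
proof -
  have "\<forall>f\<in>K. \<exists>q k. \<forall>x\<in>{x \<in> S. eval_poly (e x) d \<noteq> 0}.
      f x * eval_poly (e x) d ^ k = eval_poly (e x) q"
    using assms unfolding fraction_on_def by blast
  then obtain q k where qk: "\<And>f x. f \<in> K \<Longrightarrow> x \<in> S \<Longrightarrow> eval_poly (e x) d \<noteq> 0 \<Longrightarrow>
      f x * eval_poly (e x) d ^ k f = eval_poly (e x) (q f)"
    by (simp add: Ball_def) metis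
  have eq: "eval_poly (e x) (d * q f) \<noteq> 0 \<longleftrightarrow> eval_poly (e x) d \<noteq> 0 \<and> f x \<noteq> 0"
    if "f \<in> K" "x \<in> S" for f x
  proof (cases "eval_poly (e x) d = 0")
    case False
    then show ?thesis by (simp add: eval_poly_mult qk[OF that, symmetric])
  qed (simp add: eval_poly_mult)
  have "{x \<in> S. eval_poly (e x) d \<noteq> 0 \<and> (\<exists>f\<in>K. f x \<noteq> 0)} =
      {x \<in> S. \<exists>p\<in>(\<lambda>f. d * q f) ` K. eval_poly (e x) p \<noteq> 0}"
    using eq by auto
  then show ?thesis
    unfolding openin_pullback_zariski by blast
qed

section \<open>Evaluation of polynomials at commuting matrices\<close>

lemma monomial_induct [case_names zero variable]:
  fixes m :: "'n monomial"
  assumes "P 0" and step: "\<And>i m. P m \<Longrightarrow> P (Poly_Mapping.single i 1 + m)"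
  shows "P m"
proof (induction "\<Sum>i\<in>Poly_Mapping.keys m. Poly_Mapping.lookup m i" arbitrary: m rule: less_induct)
  case less
  show ?case
  proof (cases "m = 0")
    case False
    then obtain i where i: "i \<in> Poly_Mapping.keys m"
      using keys_eq_empty[of m] by blast
    define m' where "m' = m - Poly_Mapping.single i 1"
    have l': "Poly_Mapping.lookup m' j = Poly_Mapping.lookup m j - (if j = i then 1 else 0)" for j
      by (simp add: m'_def lookup_minus lookup_single when_def)
    have pos: "Poly_Mapping.lookup m i > 0" using i by (simp add: in_keys_iff)
    have "Poly_Mapping.keys m' \<subseteq> Poly_Mapping.keys m"
      by (auto simp: in_keys_iff l')
    then have "(\<Sum>i\<in>Poly_Mapping.keys m'. Poly_Mapping.lookup m' i)
        = (\<Sum>i\<in>Poly_Mapping.keys m. Poly_Mapping.lookup m' i)"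
      by (intro sum.mono_neutral_left) (auto simp: in_keys_iff)
    also have "\<dots> < (\<Sum>i\<in>Poly_Mapping.keys m. Poly_Mapping.lookup m i)"
      using i pos by (intro sum_strict_mono_ex1) (auto simp: l')
    finally have "P m'" by (rule less)
    moreover have "m = Poly_Mapping.single i 1 + m'"
      using pos by (intro poly_mapping_eqI) (auto simp: l' lookup_add lookup_single when_def)
    ultimately show ?thesis using step by metis
  qed (simp add: assms(1))
qed

text \<open>The value of a monomial at the tuple \<open>B\<close>. A fold over the set of variables has a specified value only if
  the order of the factors does not matter, i.e. for commuting tuples.\<close>
definition monomial_matrix :: "(complex^'c^'c)^'n::finite \<Rightarrow> 'n monomial \<Rightarrow> complex^'c^'c" where
  "monomial_matrix B m =
     Finite_Set.fold (\<lambda>i. ((**) (B $ i)) ^^ Poly_Mapping.lookup m i) (mat 1) UNIV"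

lemma fold_ignoring_elements:
  fixes S :: "'b set" and A :: 'a
  assumes "finite S"
  shows "Finite_Set.fold (\<lambda>i A. A) A S = A"
  using assms
proof (induction rule: finite_induct)
  case (insert x F)
  interpret comp_fun_commute "\<lambda>(i::'b) (A::'a). A" by standard simp
  show ?case
    using insert by (subst fold_insert) simp_all
qed simp

lemma monomial_matrix_zero [simp]: "monomial_matrix B 0 = mat 1"
  by (simp add: monomial_matrix_def id_def fold_ignoring_elements)

text \<open>Since the tuple commutes, the powers of \<open>B $ i\<close> can be made the leftmost factor; the other factors
  are the same for both monomials.\<close>
lemma monomial_matrix_variable:
  fixes B :: "(complex^'c^'c)^'n::finite"
  assumes "commuting_tuples B"
  shows "monomial_matrix B (Poly_Mapping.single i 1 + m) = B $ i ** monomial_matrix B m"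
proof -
  interpret comp_fun_commute "\<lambda>i. (**) (B $ i)"
  proof
    fix i j
    have "B $ i ** B $ j = B $ j ** B $ i"
      using assms by (cases "i = j") (auto simp: commuting_tuples_def)
    then show "(**) (B $ j) \<circ> (**) (B $ i) = (**) (B $ i) \<circ> (**) (B $ j)"
      by (auto simp: fun_eq_iff matrix_mul_assoc)
  qed
  let ?f = "\<lambda>m i. ((**) (B $ i)) ^^ Poly_Mapping.lookup m i"
  let ?m = "Poly_Mapping.single i 1 + m"
  have cfc: "comp_fun_commute (?f k)" for k
    by (rule comp_fun_commute_funpow)
  (* the power of B $ i is split off on the left *)
  have rec: "monomial_matrix B k = ?f k i (Finite_Set.fold (?f k) (mat 1) (UNIV - {i}))" for k
    unfolding monomial_matrix_def
    by (rule comp_fun_commute_on.fold_rec[OF cfc[unfolded comp_fun_commute_def']]) auto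
  have "Finite_Set.fold (?f ?m) (mat 1) (UNIV - {i}) = Finite_Set.fold (?f m) (mat 1) (UNIV - {i})"
    by (rule Finite_Set.fold_cong[OF cfc[unfolded comp_fun_commute_def'] cfc[unfolded comp_fun_commute_def']])
       (auto simp: lookup_add lookup_single)
  moreover have "Poly_Mapping.lookup ?m i = Suc (Poly_Mapping.lookup m i)"
    by (simp add: lookup_add lookup_single)
  ultimately show ?thesis
    unfolding rec[of ?m] rec[of m] by simp
qed

lemma monomial_matrix_add:
  assumes "commuting_tuples B"
  shows "monomial_matrix B (m + k) = monomial_matrix B m ** monomial_matrix B k"
  by (induction m rule: monomial_induct)
     (simp_all add: add.assoc monomial_matrix_variable[OF assms] matrix_mul_assoc del: One_nat_def)

definition poly_matrix :: "(complex^'c^'c)^'n::finite \<Rightarrow> 'n cpoly \<Rightarrow> complex^'c^'c" where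
  "poly_matrix B p =
     (\<Sum>m\<in>Poly_Mapping.keys p. mat (Poly_Mapping.lookup p m) ** monomial_matrix B m)"

lemma mat_matrix_mult_component: "(mat a ** A) $ i $ j = a * A $ i $ j"
  for A :: "complex^'c^'c"
  by (simp add: matrix_matrix_mult_def mat_def if_distrib[of "\<lambda>x. x * _"] cong: if_cong)

lemma mat_mult_vec: "(mat a :: complex^'c^'c) *v w = a *s w"
  by (simp add: vec_eq_iff matrix_vector_mult_def mat_def if_distrib[of "\<lambda>x. x * _"] cong: if_cong)

lemma mat_mult_commute: "(A ** mat a :: complex^'c^'c) = mat a ** A"
  by (simp add: vec_eq_iff matrix_matrix_mult_def mat_def if_distrib[of "\<lambda>x. x * _"]
      if_distrib[of "\<lambda>x. _ * x"] mult.commute cong: if_cong)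

lemma mat_mult_mat: "(mat a ** mat b :: complex^'c^'c) = mat (a * b)"
  by (simp add: vec_eq_iff mat_matrix_mult_component) (simp add: mat_def)

lemma mat_mult_left_commute: "A ** (mat a ** C) = mat a ** (A ** C)"
  for A C :: "complex^'c^'c"
  by (simp only: matrix_mul_assoc mat_mult_commute[of A])

lemma add_matrix_mult: "((A + A') ** C :: complex^'c^'c) = A ** C + A' ** C"
  by (simp add: vec_eq_iff matrix_matrix_mult_def distrib_right sum.distrib)

lemma poly_matrix_superset:
  assumes "finite A" "Poly_Mapping.keys p \<subseteq> A"
  shows "poly_matrix B p = (\<Sum>m\<in>A. mat (Poly_Mapping.lookup p m) ** monomial_matrix B m)"
  unfolding poly_matrix_def
  by (rule sum.mono_neutral_left) (use assms in \<open>auto simp: in_keys_iff vec_eq_iff mat_matrix_mult_component\<close>)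

lemma poly_matrix_zero [simp]: "poly_matrix B 0 = 0"
  by (simp add: poly_matrix_def)

lemma poly_matrix_single: "poly_matrix B (Poly_Mapping.single m a) = mat a ** monomial_matrix B m"
  by (subst poly_matrix_superset[of "{m}"]) auto

lemma poly_matrix_add: "poly_matrix B (p + q) = poly_matrix B p + poly_matrix B q"
proof -
  let ?A = "Poly_Mapping.keys p \<union> Poly_Mapping.keys q"
  have "Poly_Mapping.keys (p + q) \<subseteq> ?A" by (rule Poly_Mapping.keys_add)
  then show ?thesis
    by (simp add: poly_matrix_superset[of ?A] lookup_add sum.distrib[symmetric] vec_eq_iff
        mat_matrix_mult_component distrib_right)
qed

lemma cpoly_induct [case_names zero add]:
  fixes p :: "'n cpoly"
  assumes "P 0" "\<And>m a p. P p \<Longrightarrow> P (Poly_Mapping.single m a + p)"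
  shows "P p"
proof -
  have "P (\<Sum>m\<in>A. Poly_Mapping.single m (Poly_Mapping.lookup p m))" if "finite A" for A
    using that by induction (simp_all add: assms)
  then show ?thesis
    by (subst cpoly_as_sum) simp
qed

lemma poly_matrix_mult:
  assumes "commuting_tuples B"
  shows "poly_matrix B (p * q) = poly_matrix B p ** poly_matrix B q"
proof (induction p rule: cpoly_induct)
  case (add m a p)
  have "poly_matrix B (Poly_Mapping.single m a * q) = mat a ** monomial_matrix B m ** poly_matrix B q"
  proof (induction q rule: cpoly_induct)
    case (add k b q)
    have "poly_matrix B (Poly_Mapping.single m a * Poly_Mapping.single k b)
        = mat (a * b) ** (monomial_matrix B m ** monomial_matrix B k)"
      by (simp add: mult_single poly_matrix_single monomial_matrix_add[OF assms])
    also have "\<dots> = mat a ** monomial_matrix B m ** (mat b ** monomial_matrix B k)"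
      by (simp only: matrix_mul_assoc[symmetric] mat_mult_mat[symmetric]
          mat_mult_left_commute[of "monomial_matrix B m"])
    finally show ?case
      using add by (simp add: distrib_left poly_matrix_add poly_matrix_single matrix_add_ldistrib)
  qed simp
  then show ?case
    using add by (simp add: distrib_right poly_matrix_add poly_matrix_single add_matrix_mult)
qed simp

lemma poly_matrix_commute:
  assumes "commuting_tuples B"
  shows "poly_matrix B p ** poly_matrix B q = poly_matrix B q ** poly_matrix B p"
  by (metis assms mult.commute poly_matrix_mult)

lemma poly_matrix_sum: "poly_matrix B (sum f A) = (\<Sum>a\<in>A. poly_matrix B (f a))"
  by (induction A rule: infinite_finite_induct) (simp_all add: poly_matrix_add)

lemma poly_matrix_diff: "poly_matrix B (p - q) = poly_matrix B p - poly_matrix B q"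
  by (metis add_diff_cancel_right' diff_add_cancel poly_matrix_add)

lemma poly_matrix_monomial_poly: "poly_matrix B (monomial_poly m) = monomial_matrix B m"
  by (simp add: monomial_poly_def poly_matrix_single)

definition cyclic_vector :: "(complex^'c^'c)^'n::finite \<Rightarrow> complex^'c \<Rightarrow> bool" where
  "cyclic_vector B v \<longleftrightarrow> (\<forall>w. \<exists>p. poly_matrix B p *v v = w)"

text \<open>The ideal is defined without reference to a cyclic vector; this makes it a function of the tuple
  alone.\<close>
definition annihilator :: "(complex^'c^'c)^'n::finite \<Rightarrow> 'n cpoly set" where
  "annihilator B = {p. poly_matrix B p = 0}"

lemma is_ideal_annihilator:
  assumes "commuting_tuples B"
  shows "is_ideal (annihilator B)"
  unfolding is_ideal_iff annihilator_def
  by (simp add: poly_matrix_add poly_matrix_mult[OF assms])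

text \<open>An element of a commutative algebra of matrices that kills a cyclic vector kills every vector,
  because it commutes with the matrices that move the cyclic vector around.\<close>
lemma annihilator_iff_cyclic_vector:
  assumes "commuting_tuples B" "cyclic_vector B v"
  shows "p \<in> annihilator B \<longleftrightarrow> poly_matrix B p *v v = 0"
proof
  assume 0: "poly_matrix B p *v v = 0"
  have "poly_matrix B p *v w = 0" for w
  proof -
    obtain q where "poly_matrix B q *v v = w"
      using assms(2) unfolding cyclic_vector_def by blast
    then have "poly_matrix B p *v w = (poly_matrix B q ** poly_matrix B p) *v v"
      by (metis assms(1) matrix_vector_mul_assoc poly_matrix_commute)
    then show ?thesis
      by (simp add: 0 matrix_vector_mul_assoc[symmetric])
  qed
  then show "p \<in> annihilator B"
    by (simp add: annihilator_def matrix_eq)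
qed (simp add: annihilator_def)

section \<open>Ideals of finite colength and multiplication matrices\<close>

definition linear_combination :: "('c::finite \<Rightarrow> 'n cpoly) \<Rightarrow> complex^'c \<Rightarrow> 'n cpoly" where
  "linear_combination \<beta> x = (\<Sum>j\<in>UNIV. Poly_Mapping.single 0 (x $ j) * \<beta> j)"

lemma linear_combination_add:
  "linear_combination \<beta> (x + y) = linear_combination \<beta> x + linear_combination \<beta> y"
  by (simp add: linear_combination_def single_add distrib_right sum.distrib)

lemma linear_combination_scale:
  "linear_combination \<beta> (a *s x) = Poly_Mapping.single 0 a * linear_combination \<beta> x"
  by (simp add: linear_combination_def sum_distrib_left mult_single flip: mult.assoc)

lemma linear_combination_zero [simp]: "linear_combination \<beta> 0 = 0"
  by (simp add: linear_combination_def)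

lemma expands_mod_range_iff:
  assumes "inj \<beta>"
  shows "expands_mod I (range \<beta>) p a \<longleftrightarrow>
    (\<forall>b. b \<notin> range \<beta> \<longrightarrow> a b = 0) \<and> p - linear_combination \<beta> (\<chi> j. a (\<beta> j)) \<in> I"
  unfolding expands_mod_def linear_combination_def
  by (simp add: sum.reindex[OF assms] comp_def)

text \<open>The chart coordinates are functions on all monomials that vanish outside the basis, whereas linear
  algebra needs vectors indexed by a finite type. For an injective family \<open>\<beta>\<close> this function and
  \<open>\<lambda>a. \<chi> j. a (\<beta> j)\<close> translate between the two.\<close>
definition extend_by_zero :: "('c::finite \<Rightarrow> 'b) \<Rightarrow> complex^'c \<Rightarrow> 'b \<Rightarrow> complex" where
  "extend_by_zero \<beta> x b = (if b \<in> range \<beta> then x $ inv \<beta> b else 0)"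

lemma expands_mod_iff_linear_combination:
  assumes "inj \<beta>"
  shows "expands_mod I (range \<beta>) p a \<longleftrightarrow>
    (\<exists>x. a = extend_by_zero \<beta> x \<and> p - linear_combination \<beta> x \<in> I)"
proof
  assume "expands_mod I (range \<beta>) p a"
  then have "a = extend_by_zero \<beta> (\<chi> j. a (\<beta> j))"
    and "p - linear_combination \<beta> (\<chi> j. a (\<beta> j)) \<in> I"
    using assms by (auto simp: expands_mod_range_iff fun_eq_iff extend_by_zero_def)
  then show "\<exists>x. a = extend_by_zero \<beta> x \<and> p - linear_combination \<beta> x \<in> I" by blast
next
  assume "\<exists>x. a = extend_by_zero \<beta> x \<and> p - linear_combination \<beta> x \<in> I"
  then show "expands_mod I (range \<beta>) p a"
    using assms by (auto simp: expands_mod_range_iff extend_by_zero_def)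
qed

lemma inj_extend_by_zero:
  assumes "inj \<beta>" "extend_by_zero \<beta> x = extend_by_zero \<beta> y"
  shows "x = y"
proof -
  have "extend_by_zero \<beta> x (\<beta> j) = extend_by_zero \<beta> y (\<beta> j)" for j
    using assms(2) by simp
  then show ?thesis
    using assms(1) by (simp add: extend_by_zero_def vec_eq_iff)
qed

lemma quotient_basis_range_iff:
  assumes "inj (\<beta> :: 'c::finite \<Rightarrow> 'n cpoly)"
  shows "quotient_basis I (range \<beta>) \<longleftrightarrow> (\<forall>p. \<exists>!x. p - linear_combination \<beta> x \<in> I)"
proof -
  have "(\<exists>!a. expands_mod I (range \<beta>) p a) \<longleftrightarrow> (\<exists>!x. p - linear_combination \<beta> x \<in> I)" for p
    unfolding expands_mod_iff_linear_combination[OF assms]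
    by (auto dest: inj_extend_by_zero[OF assms])
  then show ?thesis
    unfolding quotient_basis_def by simp
qed

definition coordinate_vector ::
    "'n cpoly set \<Rightarrow> ('c::finite \<Rightarrow> 'n cpoly) \<Rightarrow> 'n cpoly \<Rightarrow> complex^'c" where
  "coordinate_vector I \<beta> p = (\<chi> j. quotient_coords I (range \<beta>) p (\<beta> j))"

lemma quotient_coords_eq:
  assumes "inj \<beta>" "quotient_basis I (range \<beta>)" "p - linear_combination \<beta> x \<in> I"
  shows "quotient_coords I (range \<beta>) p = extend_by_zero \<beta> x"
proof -
  have "expands_mod I (range \<beta>) p (extend_by_zero \<beta> x)"
    using assms by (auto simp: expands_mod_iff_linear_combination)
  moreover have "\<exists>!a. expands_mod I (range \<beta>) p a"
    using assms(2) by (simp add: quotient_basis_def)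
  ultimately show ?thesis
    unfolding quotient_coords_def by (simp add: the1_equality)
qed

text \<open>All properties of coordinate vectors are derived from this characterisation: they are the
  coefficients of the unique linear combination of \<open>\<beta>\<close> congruent to \<open>p\<close> modulo \<open>I\<close>.\<close>
lemma coordinate_vector_eq_iff:
  assumes "inj \<beta>" "quotient_basis I (range \<beta>)"
  shows "coordinate_vector I \<beta> p = x \<longleftrightarrow> p - linear_combination \<beta> x \<in> I"
proof -
  have *: "coordinate_vector I \<beta> p = y" if "p - linear_combination \<beta> y \<in> I" for y
    using quotient_coords_eq[OF assms that] assms(1)
    by (simp add: coordinate_vector_def extend_by_zero_def vec_eq_iff)
  obtain y where "p - linear_combination \<beta> y \<in> I"
    using assms quotient_basis_range_iff by blast
  then show ?thesis using * by metis
qed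

text \<open>The matrices of multiplication by the variables on the quotient by \<open>I\<close>, in the basis \<open>\<beta>\<close>.\<close>
definition multiplication_matrices ::
    "'n cpoly set \<Rightarrow> ('c::finite \<Rightarrow> 'n cpoly) \<Rightarrow> (complex^'c^'c)^'n" where
  "multiplication_matrices I \<beta> =
     (\<chi> i j k. coordinate_vector I \<beta> (monomial_poly (Poly_Mapping.single i 1) * \<beta> k) $ j)"

context
  fixes I :: "'n::finite cpoly set" and \<beta> :: "'c::finite \<Rightarrow> 'n cpoly"
  assumes ideal: "is_ideal I" and inj: "inj \<beta>" and basis: "quotient_basis I (range \<beta>)"
begin

lemma ideal_zero: "0 \<in> I"
  and ideal_add: "p \<in> I \<Longrightarrow> q \<in> I \<Longrightarrow> p + q \<in> I"
  and ideal_mult: "p \<in> I \<Longrightarrow> r * p \<in> I"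
  using ideal by (simp_all add: is_ideal_iff)

lemmas coordinate_iff = coordinate_vector_eq_iff[OF inj basis]

lemma coordinate_vector_mod: "p - linear_combination \<beta> (coordinate_vector I \<beta> p) \<in> I"
  by (rule coordinate_iff[THEN iffD1, OF refl])

lemma coordinate_vector_eq_0_iff: "coordinate_vector I \<beta> p = 0 \<longleftrightarrow> p \<in> I"
  by (simp add: coordinate_iff)

lemma coordinate_vector_add:
  "coordinate_vector I \<beta> (p + q) = coordinate_vector I \<beta> p + coordinate_vector I \<beta> q"
proof -
  let ?k = "coordinate_vector I \<beta>"
  have "p + q - linear_combination \<beta> (?k p + ?k q) =
      (p - linear_combination \<beta> (?k p)) + (q - linear_combination \<beta> (?k q))"
    by (simp add: linear_combination_add)
  then show ?thesis
    unfolding coordinate_iff by (simp only: ideal_add coordinate_vector_mod)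
qed

lemma coordinate_vector_scale:
  "coordinate_vector I \<beta> (Poly_Mapping.single 0 a * p) = a *s coordinate_vector I \<beta> p"
proof -
  let ?k = "coordinate_vector I \<beta>"
  have "Poly_Mapping.single 0 a * p - linear_combination \<beta> (a *s ?k p) =
      Poly_Mapping.single 0 a * (p - linear_combination \<beta> (?k p))"
    by (simp add: linear_combination_scale right_diff_distrib)
  then show ?thesis
    unfolding coordinate_iff by (simp only: ideal_mult coordinate_vector_mod)
qed

lemma coordinate_vector_sum:
  "coordinate_vector I \<beta> (\<Sum>a\<in>A. f a) = (\<Sum>a\<in>A. coordinate_vector I \<beta> (f a))"
  by (induction A rule: infinite_finite_induct)
     (simp_all add: coordinate_vector_add coordinate_vector_eq_0_iff ideal_zero)

lemma coordinate_vector_linear_combination: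
  "coordinate_vector I \<beta> (linear_combination \<beta> x) = x"
  by (simp add: coordinate_iff ideal_zero)

lemma coordinate_vector_variable_mult:
  "coordinate_vector I \<beta> (monomial_poly (Poly_Mapping.single i 1) * p) =
    multiplication_matrices I \<beta> $ i *v coordinate_vector I \<beta> p"
proof -
  let ?X = "monomial_poly (Poly_Mapping.single i 1) :: 'n cpoly"
  define x where "x = coordinate_vector I \<beta> p"
  have "?X * (p - linear_combination \<beta> x) \<in> I"
    unfolding x_def using coordinate_vector_mod by (rule ideal_mult)
  moreover have "?X * p = ?X * linear_combination \<beta> x + ?X * (p - linear_combination \<beta> x)"
    by (simp add: right_diff_distrib)
  ultimately have "coordinate_vector I \<beta> (?X * p) = coordinate_vector I \<beta> (?X * linear_combination \<beta> x)"
    by (simp only: coordinate_vector_add coordinate_vector_eq_0_iff[THEN iffD2] add_0_right)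
  also have "?X * linear_combination \<beta> x = (\<Sum>k\<in>UNIV. Poly_Mapping.single 0 (x $ k) * (?X * \<beta> k))"
    by (simp add: linear_combination_def sum_distrib_left mult.left_commute)
  also have "coordinate_vector I \<beta> \<dots> = multiplication_matrices I \<beta> $ i *v x"
    by (simp add: coordinate_vector_sum coordinate_vector_scale vec_eq_iff matrix_vector_mult_def
        multiplication_matrices_def mult.commute)
  finally show ?thesis by (simp add: x_def)
qed

text \<open>On the coordinate vector of a polynomial, and every vector is one, the matrices act by
  multiplication of that polynomial by the variables, which commute.\<close>
lemma commuting_multiplication_matrices: "commuting_tuples (multiplication_matrices I \<beta>)"
proof -
  let ?S = "multiplication_matrices I \<beta>"
  have "(?S $ i ** ?S $ j) *v w = (?S $ j ** ?S $ i) *v w" for i j w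
  proof -
    define p where "p = linear_combination \<beta> w"
    have w: "w = coordinate_vector I \<beta> p"
      by (simp add: p_def coordinate_vector_linear_combination)
    show ?thesis
      unfolding w matrix_vector_mul_assoc[symmetric] coordinate_vector_variable_mult[symmetric]
      by (simp only: mult.left_commute)
  qed
  then show ?thesis
    by (simp add: commuting_tuples_def matrix_eq)
qed

text \<open>The class of \<open>p\<close> in the quotient is \<open>p\<close> acting on the class of \<open>1\<close>. Hence the class of \<open>1\<close> is a
  cyclic vector, and the polynomials that kill it are those in \<open>I\<close>.\<close>
lemma coordinate_vector_eq_poly_matrix:
  "coordinate_vector I \<beta> p =
    poly_matrix (multiplication_matrices I \<beta>) p *v coordinate_vector I \<beta> 1"
proof (induction p rule: cpoly_induct)
  case zero
  show ?case by (simp add: coordinate_vector_eq_0_iff ideal_zero)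
next
  case (add m a p)
  let ?S = "multiplication_matrices I \<beta>"
  have "coordinate_vector I \<beta> (monomial_poly m) = monomial_matrix ?S m *v coordinate_vector I \<beta> 1"
  proof (induction m rule: monomial_induct)
    case zero
    show ?case by (simp add: monomial_poly_def)
  next
    case (variable i m)
    have "monomial_poly (Poly_Mapping.single i 1 + m)
        = monomial_poly (Poly_Mapping.single i 1) * monomial_poly m"
      by (simp add: monomial_poly_def mult_single)
    then show ?case
      by (simp only: coordinate_vector_variable_mult variable
          monomial_matrix_variable[OF commuting_multiplication_matrices] matrix_vector_mul_assoc)
  qed
  moreover have "Poly_Mapping.single m a = Poly_Mapping.single 0 a * monomial_poly m"
    by (simp add: monomial_poly_def mult_single)
  ultimately have "coordinate_vector I \<beta> (Poly_Mapping.single m a) =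
      poly_matrix ?S (Poly_Mapping.single m a) *v coordinate_vector I \<beta> 1"
    by (simp add: coordinate_vector_scale poly_matrix_single mat_mult_vec
        poly_matrix_mult[OF commuting_multiplication_matrices]
        matrix_vector_mul_assoc[symmetric] poly_matrix_monomial_poly)
  then show ?case
    by (simp add: coordinate_vector_add poly_matrix_add add matrix_vector_mult_add_rdistrib)
qed

lemma cyclic_vector_multiplication_matrices:
  "cyclic_vector (multiplication_matrices I \<beta>) (coordinate_vector I \<beta> 1)"
  unfolding cyclic_vector_def coordinate_vector_eq_poly_matrix[symmetric]
  using coordinate_vector_linear_combination by blast

lemma annihilator_multiplication_matrices: "annihilator (multiplication_matrices I \<beta>) = I"
  using annihilator_iff_cyclic_vector[OF commuting_multiplication_matrices
      cyclic_vector_multiplication_matrices]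
  by (auto simp: coordinate_vector_eq_poly_matrix[symmetric] coordinate_vector_eq_0_iff)

end

section \<open>Cyclic vectors and bases of monomials\<close>

lemma obtain_enumeration:
  assumes "finite M" "card M = CARD('c::finite)"
  obtains \<beta> :: "'c::finite \<Rightarrow> 'b" where "inj \<beta>" "range \<beta> = M"
proof -
  obtain \<beta> :: "'c \<Rightarrow> 'b" where "bij_betw \<beta> UNIV M"
    using finite_same_card_bij[of "UNIV :: 'c set" M] assms by auto
  then show thesis using that by (auto simp: bij_betw_def)
qed

lemma fraction_on_monomial_matrix:
  "fraction_on matrix_entries {B :: (complex^'c^'c)^'n::finite. commuting_tuples B} d
     (\<lambda>B. monomial_matrix B m $ i $ j)"
proof (induction m arbitrary: i j rule: monomial_induct)
  case zero
  show ?case by (simp add: fraction_on_const)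
next
  case (variable l m)
  have "fraction_on matrix_entries {B :: (complex^'c^'c)^'n. commuting_tuples B} d (\<lambda>B. B $ l $ i $ k)" for k
    using fraction_on_coordinate[of matrix_entries "{B :: (complex^'c^'c)^'n. commuting_tuples B}" d "(l, i, k)"]
    by (simp add: matrix_entries_def)
  then have "fraction_on matrix_entries {B :: (complex^'c^'c)^'n. commuting_tuples B} d
      (\<lambda>B. \<Sum>k\<in>UNIV. B $ l $ i $ k * monomial_matrix B m $ k $ j)"
    by (intro fraction_on_sum fraction_on_mult variable)
  then show ?case
    by (rule fraction_on_cong)
       (simp add: monomial_matrix_variable matrix_matrix_mult_def del: One_nat_def)
qed

text \<open>The columns are the images of \<open>v\<close> under the values at \<open>B\<close> of the monomials \<open>\<beta> j\<close>. For a commuting tuple they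
  form a basis iff \<open>v\<close> is cyclic and the monomials form a basis of the quotient by the annihilator of \<open>B\<close>.\<close>
definition frame_matrix ::
    "(complex^'c^'c)^'n::finite \<Rightarrow> complex^'c \<Rightarrow> ('c \<Rightarrow> 'n monomial) \<Rightarrow> complex^'c^'c" where
  "frame_matrix B v \<beta> = (\<chi> i j. (monomial_matrix B (\<beta> j) *v v) $ i)"

lemma sum_matrix_vector_mult: "(\<Sum>a\<in>A. f a) *v v = (\<Sum>a\<in>A. f a *v v)"
  for f :: "'b \<Rightarrow> complex^'c^'c"
  by (induction A rule: infinite_finite_induct) (simp_all add: matrix_vector_mult_add_rdistrib)

lemma frame_matrix_mult:
  "frame_matrix B v \<beta> *v x = (\<Sum>j\<in>UNIV. x $ j *s (monomial_matrix B (\<beta> j) *v v))"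
proof -
  have "frame_matrix B v \<beta> $ i $ j = (monomial_matrix B (\<beta> j) *v v) $ i" for i j
    by (simp add: frame_matrix_def)
  then show ?thesis
    by (simp add: vec_eq_iff matrix_vector_mult_def[of "frame_matrix B v \<beta>"] mult.commute)
qed

lemma poly_matrix_linear_combination:
  fixes B :: "(complex^'c^'c)^'n::finite"
  shows "poly_matrix B (linear_combination (monomial_poly \<circ> \<beta>) x) *v v = frame_matrix B v \<beta> *v x"
proof -
  have "Poly_Mapping.single 0 a * monomial_poly m = Poly_Mapping.single m a" for a and m :: "'n monomial"
    by (simp add: monomial_poly_def mult_single)
  then show ?thesis
    by (simp add: linear_combination_def poly_matrix_sum poly_matrix_single frame_matrix_mult
        sum_matrix_vector_mult mat_mult_vec matrix_vector_mul_assoc[symmetric])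
qed

lemma det_nonzero_iff_surj: "det A \<noteq> 0 \<longleftrightarrow> surj ((*v) A)" for A :: "complex^'c^'c"
  by (simp add: invertible_det_nz[symmetric] invertible_right_inverse matrix_right_invertible_surjective)

lemma inj_monomial_poly_comp: "inj \<beta> \<Longrightarrow> inj (monomial_poly \<circ> \<beta>)"
  using inj_monomial_poly by (rule inj_compose)

lemma hilb_chart_range_iff:
  "I \<in> hilb_chart (range \<beta>) \<longleftrightarrow> is_ideal I \<and> quotient_basis I (range (monomial_poly \<circ> \<beta>))"
  by (simp add: hilb_chart_def image_comp)

text \<open>If \<open>v\<close> is cyclic, then evaluation \<open>p \<mapsto> p(B) v\<close> identifies the quotient by the annihilator with
  the space of vectors. Expanding a monomial in the basis \<open>\<beta>\<close> of the quotient is therefore the same as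
  solving a linear system with the frame matrix, and Cramer's rule gives the solution.\<close>
lemma
  fixes B :: "(complex^'c^'c)^'n::finite"
  assumes B: "commuting_tuples B" and \<beta>: "inj \<beta>" and det: "det (frame_matrix B v \<beta>) \<noteq> 0"
  shows cyclic_vector_of_frame: "cyclic_vector B v"
    and annihilator_in_chart_of_frame: "annihilator B \<in> hilb_chart (range \<beta>)"
    and chart_coords_of_frame: "chart_coords (range \<beta>) (annihilator B) (m, b) =
      extend_by_zero \<beta> (\<chi> k. det (\<chi> i j. if j = k then (monomial_matrix B m *v v) $ i
         else frame_matrix B v \<beta> $ i $ j) / det (frame_matrix B v \<beta>)) b"
proof -
  let ?D = "frame_matrix B v \<beta>"
  let ?x = "\<lambda>w. \<chi> k. det (\<chi> i j. if j = k then w $ i else ?D $ i $ j) / det ?D"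
  have cramer_D: "?D *v x = w \<longleftrightarrow> x = ?x w" for x w
    by (rule cramer[OF det])
  have "poly_matrix B (linear_combination (monomial_poly \<circ> \<beta>) (?x w)) *v v = w" for w
    unfolding poly_matrix_linear_combination cramer_D ..
  then show cyc: "cyclic_vector B v"
    unfolding cyclic_vector_def by blast
  have iff: "p - linear_combination (monomial_poly \<circ> \<beta>) x \<in> annihilator B \<longleftrightarrow>
      x = ?x (poly_matrix B p *v v)" for p x
    unfolding annihilator_iff_cyclic_vector[OF B cyc] poly_matrix_diff matrix_vector_mult_diff_rdistrib
      poly_matrix_linear_combination cramer_D[symmetric] by auto
  have inj: "inj (monomial_poly \<circ> \<beta>)"
    using \<beta> by (rule inj_monomial_poly_comp)
  have basis: "quotient_basis (annihilator B) (range (monomial_poly \<circ> \<beta>))"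
    unfolding quotient_basis_range_iff[OF inj] iff by blast
  then show "annihilator B \<in> hilb_chart (range \<beta>)"
    using is_ideal_annihilator[OF B] by (simp add: hilb_chart_range_iff)
  have "quotient_coords (annihilator B) (range (monomial_poly \<circ> \<beta>)) (monomial_poly m) =
      extend_by_zero (monomial_poly \<circ> \<beta>) (?x (monomial_matrix B m *v v))"
    by (rule quotient_coords_eq[OF inj basis]) (simp only: iff poly_matrix_monomial_poly)
  moreover have "extend_by_zero (monomial_poly \<circ> \<beta>) x (monomial_poly b) = extend_by_zero \<beta> x b" for x
  proof (cases "b \<in> range \<beta>")
    case True
    then obtain j where "b = \<beta> j" by blast
    then show ?thesis
      using inv_f_f[OF inj, of j] inv_f_f[OF \<beta>, of j] by (simp add: extend_by_zero_def)
  next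
    case False
    then have "monomial_poly b \<notin> range (monomial_poly \<circ> \<beta>)"
      using inj_monomial_poly by (auto dest: injD)
    with False show ?thesis by (simp add: extend_by_zero_def)
  qed
  ultimately show "chart_coords (range \<beta>) (annihilator B) (m, b) =
      extend_by_zero \<beta> (?x (monomial_matrix B m *v v)) b"
    by (simp add: chart_coords_def image_comp)
qed

lemma det_frame_matrix_nonzero:
  assumes "inj \<beta>" "commuting_tuples B" "cyclic_vector B v" "annihilator B \<in> hilb_chart (range \<beta>)"
  shows "det (frame_matrix B v \<beta>) \<noteq> 0"
  unfolding det_nonzero_iff_surj
proof (rule surjI)
  fix w
  define p where "p = (SOME p. poly_matrix B p *v v = w)"
  have p: "poly_matrix B p *v v = w"
    unfolding p_def using assms(3) unfolding cyclic_vector_def by (metis (mono_tags) someI_ex)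
  let ?x = "coordinate_vector (annihilator B) (monomial_poly \<circ> \<beta>) p"
  have "p - linear_combination (monomial_poly \<circ> \<beta>) ?x \<in> annihilator B"
    using assms(4) unfolding hilb_chart_range_iff
    by (metis coordinate_vector_eq_iff inj_monomial_poly_comp[OF assms(1)])
  then have "poly_matrix B (linear_combination (monomial_poly \<circ> \<beta>) ?x) = poly_matrix B p"
    by (simp add: annihilator_def poly_matrix_diff)
  then show "frame_matrix B v \<beta> *v coordinate_vector (annihilator B) (monomial_poly \<circ> \<beta>)
      (SOME p. poly_matrix B p *v v = w) = w"
    using p by (simp add: poly_matrix_linear_combination[symmetric] p_def[symmetric])
qed

text \<open>The values of the monomials at \<open>B\<close>, applied to a cyclic vector, span the space; a basis can be
  selected among them.\<close>
lemma exists_frame: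
  fixes B :: "(complex^'c^'c)^'n::finite"
  assumes "cyclic_vector B v"
  obtains \<beta> where "inj \<beta>" "det (frame_matrix B v \<beta>) \<noteq> 0"
proof -
  let ?T = "range (\<lambda>m. monomial_matrix B m *v v)"
  have span: "w \<in> vec.span ?T" for w
  proof -
    obtain p where "w = poly_matrix B p *v v"
      using assms unfolding cyclic_vector_def by metis
    then have "w = (\<Sum>m\<in>Poly_Mapping.keys p. Poly_Mapping.lookup p m *s (monomial_matrix B m *v v))"
      by (simp add: poly_matrix_def sum_matrix_vector_mult mat_mult_vec matrix_vector_mul_assoc[symmetric])
    moreover have "\<dots> \<in> vec.span ?T"
      by (intro vec.span_sum vec.span_scale vec.span_base rangeI)
    ultimately show ?thesis by (simp only:)
  qed
  obtain E where E: "E \<subseteq> ?T" "vec.independent E" "?T \<subseteq> vec.span E" "card E = vec.dim ?T"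
    using vec.basis_exists by blast
  have span_E: "w \<in> vec.span E" for w
    using span[of w] vec.span_minimal[OF E(3) vec.subspace_span] by blast
  have "vec.dim ?T = CARD('c)"
    using span vec.dim_span[of ?T] by (metis UNIV_eq_I vec_dim_card)
  moreover have fin: "finite E"
    using E(2) by (rule vec.finiteI_independent)
  ultimately obtain \<gamma> :: "'c \<Rightarrow> _" where \<gamma>: "inj \<gamma>" "range \<gamma> = E"
    using E(4) obtain_enumeration[of E] by metis
  have "\<forall>j. \<exists>m. \<gamma> j = monomial_matrix B m *v v"
    using \<gamma> E(1) by blast
  then obtain \<beta> where \<beta>: "\<And>j. \<gamma> j = monomial_matrix B (\<beta> j) *v v"
    by metis
  have "inj \<beta>"
    using \<gamma>(1) \<beta> by (metis injD injI)
  moreover have "\<exists>x. frame_matrix B v \<beta> *v x = w" for w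
  proof -
    obtain u where "w = (\<Sum>a\<in>E. u a *s a)"
      using span_E[of w] unfolding vec.span_finite[OF fin] by auto
    also have "\<dots> = (\<Sum>j\<in>UNIV. u (\<gamma> j) *s \<gamma> j)"
      using sum.reindex[OF \<gamma>(1), of "\<lambda>a. u a *s a"] \<gamma>(2) by simp
    finally have "frame_matrix B v \<beta> *v (\<chi> j. u (\<gamma> j)) = w"
      by (simp add: frame_matrix_mult \<beta>)
    then show ?thesis by blast
  qed
  ultimately show thesis
    using that unfolding det_nonzero_iff_surj surj_def by metis
qed

section \<open>The annihilator map and its sections over the charts\<close>

definition cyclic_tuples :: "((complex^'c^'c)^'n::finite) set" where
  "cyclic_tuples = {B. commuting_tuples B \<and> (\<exists>v. cyclic_vector B v)}"

text \<open>Continuity of \<open>annihilator\<close>, one chart at a time. A vector \<open>v\<close> that is cyclic for a tuple \<open>B0\<close> remains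
  cyclic as long as the frame determinant at \<open>v\<close> does not vanish. On this neighbourhood of \<open>B0\<close>, with
  \<open>v\<close> fixed, the chart coordinates of the annihilator are fractions whose denominator is that
  determinant.\<close>
lemma openin_annihilator_in_chart:
  fixes \<beta> :: "'c::finite \<Rightarrow> 'n::finite monomial"
  assumes \<beta>: "inj \<beta>" and U: "openin (chart_topology (range \<beta>)) U"
  shows "openin commuting_variety {B :: (complex^'c^'c)^'n. B \<in> cyclic_tuples \<and> annihilator B \<in> U}"
proof (subst openin_subopen, intro ballI)
  fix B0 :: "(complex^'c^'c)^'n"
  assume "B0 \<in> {B \<in> cyclic_tuples. annihilator B \<in> U}"
  then obtain v where B0: "commuting_tuples B0" "cyclic_vector B0 v" "annihilator B0 \<in> U"
    unfolding cyclic_tuples_def by blast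
  obtain P where P: "U = {I \<in> hilb_chart (range \<beta>). \<exists>p\<in>P. eval_poly (chart_coords (range \<beta>) I) p \<noteq> 0}"
    using U unfolding chart_topology_def openin_pullback_zariski by blast
  let ?C = "{B :: (complex^'c^'c)^'n. commuting_tuples B}"
  let ?e = "matrix_entries :: (complex^'c^'c)^'n \<Rightarrow> _"
  have regular: "fraction_on ?e ?C d (\<lambda>B. (monomial_matrix B m *v v) $ i)" for d m i
    by (simp add: matrix_vector_mult_def)
       (intro fraction_on_sum fraction_on_mult fraction_on_monomial_matrix fraction_on_const)
  then have regular_frame: "fraction_on ?e ?C d (\<lambda>B. frame_matrix B v \<beta> $ i $ j)" for d i j
    by (simp add: frame_matrix_def)
  obtain d where d: "\<And>B. B \<in> ?C \<Longrightarrow> det (frame_matrix B v \<beta>) = eval_poly (?e B) d"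
    using fraction_on_1D[OF fraction_on_det[OF regular_frame]] by blast
  let ?N = "{B \<in> ?C. eval_poly (?e B) d \<noteq> 0}"
  have "fraction_on ?e ?N d (\<lambda>B. chart_coords (range \<beta>) (annihilator B) mb)" for mb
  proof (cases mb)
    case (Pair m b)
    let ?x = "\<lambda>B k. det (\<chi> i j. if j = k then (monomial_matrix B m *v v) $ i else frame_matrix B v \<beta> $ i $ j)
        / eval_poly (?e B) d"
    have "fraction_on ?e ?C 1 (\<lambda>B. if j = k then (monomial_matrix B m *v v) $ i
        else frame_matrix B v \<beta> $ i $ j)" for i j k
      by (cases "j = k") (simp_all add: regular regular_frame)
    then have "fraction_on ?e ?C 1 (\<lambda>B. det (\<chi> i j. if j = k then (monomial_matrix B m *v v) $ i
        else frame_matrix B v \<beta> $ i $ j))" for k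
      by (intro fraction_on_det) simp
    then have x: "fraction_on ?e ?N d (\<lambda>B. ?x B k)" for k
      by (rule fraction_on_divide) auto
    have "fraction_on ?e ?N d (\<lambda>B. if b \<in> range \<beta> then ?x B (inv \<beta> b) else 0)"
      by (cases "b \<in> range \<beta>") (simp_all only: if_True if_False x fraction_on_const)
    then show ?thesis
    proof (rule fraction_on_cong)
      fix B assume "B \<in> ?N"
      then have "commuting_tuples B" "det (frame_matrix B v \<beta>) \<noteq> 0" using d by auto
      then show "(if b \<in> range \<beta> then ?x B (inv \<beta> b) else 0) = chart_coords (range \<beta>) (annihilator B) mb"
        using chart_coords_of_frame[of B \<beta> v m b] \<beta> d Pair by (simp add: extend_by_zero_def)
    qed
  qed
  then have "fraction_on ?e ?N d (\<lambda>B. eval_poly (chart_coords (range \<beta>) (annihilator B)) p)" for p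
    by (rule fraction_on_eval_poly)
  then have "openin commuting_variety {B \<in> ?C. eval_poly (?e B) d \<noteq> 0 \<and>
      (\<exists>f\<in>(\<lambda>p B. eval_poly (chart_coords (range \<beta>) (annihilator B)) p) ` P. f B \<noteq> 0)}" (is "openin _ ?T")
    unfolding commuting_variety_def by (intro openin_nonvanishing_fractions) blast
  moreover have "B0 \<in> ?T"
  proof -
    have "det (frame_matrix B0 v \<beta>) \<noteq> 0"
      using det_frame_matrix_nonzero[OF \<beta> B0(1,2)] B0(3) P by blast
    then show ?thesis using B0 P d by auto
  qed
  moreover have "?T \<subseteq> {B \<in> cyclic_tuples. annihilator B \<in> U}"
  proof
    fix B assume B: "B \<in> ?T"
    then have "commuting_tuples B" "det (frame_matrix B v \<beta>) \<noteq> 0" using d by auto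
    then have "cyclic_vector B v" "annihilator B \<in> hilb_chart (range \<beta>)"
      using cyclic_vector_of_frame annihilator_in_chart_of_frame \<beta> by blast+
    then show "B \<in> {B \<in> cyclic_tuples. annihilator B \<in> U}"
      using B P unfolding cyclic_tuples_def by auto
  qed
  ultimately show "\<exists>T. openin commuting_variety T \<and> B0 \<in> T \<and> T \<subseteq> {B \<in> cyclic_tuples. annihilator B \<in> U}"
    by (intro exI conjI)
qed

text \<open>Continuity of the section over a chart: the product of a variable with a basis monomial is again
  a monomial, so the entries of the multiplication matrices are themselves chart coordinates.\<close>
lemma openin_multiplication_matrices_preimage:
  fixes \<beta> :: "'c::finite \<Rightarrow> 'n::finite monomial"
  assumes T: "openin commuting_variety T" and \<beta>: "inj \<beta>"
  shows "openin (chart_topology (range \<beta>))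
    {I \<in> hilb_chart (range \<beta>). multiplication_matrices I (monomial_poly \<circ> \<beta>) \<in> T}"
proof -
  let ?s = "\<lambda>I. multiplication_matrices I (monomial_poly \<circ> \<beta>)"
  let ?M = "range \<beta>"
  obtain P where P: "T = {B. commuting_tuples B \<and> (\<exists>p\<in>P. eval_poly (matrix_entries B) p \<noteq> 0)}"
    using T unfolding commuting_variety_def openin_pullback_zariski by auto
  have entry: "matrix_entries (?s I) (i, j, k) =
      chart_coords ?M I (Poly_Mapping.single i 1 + \<beta> k, \<beta> j)" for I i j k
    by (simp add: matrix_entries_def multiplication_matrices_def coordinate_vector_def chart_coords_def
        image_comp monomial_poly_def mult_single)
  have "fraction_on (chart_coords ?M) S 1 (\<lambda>I. matrix_entries (?s I) ijk)" for S ijk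
    by (cases ijk) (simp only: entry fraction_on_coordinate)
  then have "fraction_on (chart_coords ?M) S 1 (\<lambda>I. eval_poly (matrix_entries (?s I)) p)" for S p
    by (rule fraction_on_eval_poly)
  then have "openin (chart_topology ?M) {I \<in> hilb_chart ?M. eval_poly (chart_coords ?M I) 1 \<noteq> 0 \<and>
      (\<exists>f\<in>(\<lambda>p I. eval_poly (matrix_entries (?s I)) p) ` P. f I \<noteq> 0)}"
    unfolding chart_topology_def by (intro openin_nonvanishing_fractions) blast
  moreover have "commuting_tuples (?s I)" if "I \<in> hilb_chart ?M" for I
    using that commuting_multiplication_matrices[OF _ inj_monomial_poly_comp[OF \<beta>]]
    by (simp add: hilb_chart_range_iff)
  ultimately show ?thesis
    unfolding P by (auto elim!: back_subst[of "openin _"])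
qed

lemma
  fixes I :: "'n::finite cpoly set" and \<beta> :: "'c::finite \<Rightarrow> 'n monomial"
  assumes "I \<in> hilb_chart (range \<beta>)" "inj \<beta>"
  shows multiplication_matrices_cyclic: "multiplication_matrices I (monomial_poly \<circ> \<beta>) \<in> cyclic_tuples"
    and annihilator_chart_section: "annihilator (multiplication_matrices I (monomial_poly \<circ> \<beta>)) = I"
  using assms cyclic_vector_multiplication_matrices commuting_multiplication_matrices
    annihilator_multiplication_matrices inj_monomial_poly_comp[OF assms(2)]
  unfolding cyclic_tuples_def hilb_chart_range_iff by blast+

text \<open>The charts are glued along open sets: an open set of one chart has an open trace on every other. The
  transition from one chart to another is continuous because it factors through the commuting variety:
  it is the section over one chart followed by \<open>annihilator\<close>.\<close>
lemma chart_openin_hilbert_scheme: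
  fixes \<beta> :: "'c::finite \<Rightarrow> 'n::finite monomial"
  assumes \<beta>: "inj \<beta>" and U: "openin (chart_topology (range \<beta>)) U"
  shows "openin (hilbert_scheme CARD('c)) U"
  unfolding openin_hilbert_scheme
proof (intro conjI allI impI)
  have "U \<subseteq> hilb_chart (range \<beta>)"
    using openin_subset[OF U] by simp
  also have "\<dots> \<subseteq> hilb_points CARD('c)"
    using \<beta> by (intro hilb_chart_subset) (simp_all add: card_image)
  finally show "U \<subseteq> hilb_points CARD('c)" .
  fix M :: "'n monomial set"
  assume "finite M \<and> card M = CARD('c)"
  then obtain \<beta>' :: "'c \<Rightarrow> 'n monomial" where \<beta>': "inj \<beta>'" "range \<beta>' = M"
    using obtain_enumeration[where 'c = 'c, of M] by blast
  let ?T = "{B :: (complex^'c^'c)^'n. B \<in> cyclic_tuples \<and> annihilator B \<in> U}"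
  have "U \<inter> hilb_chart M = {I \<in> hilb_chart (range \<beta>'). multiplication_matrices I (monomial_poly \<circ> \<beta>') \<in> ?T}"
    using \<beta>' multiplication_matrices_cyclic[OF _ \<beta>'(1)] annihilator_chart_section[OF _ \<beta>'(1)] by auto
  then show "openin (chart_topology M) (U \<inter> hilb_chart M)"
    using openin_multiplication_matrices_preimage[OF openin_annihilator_in_chart[OF \<beta> U] \<beta>'(1)]
    by (simp add: \<beta>'(2))
qed

lemma cyclic_tuple_in_chart:
  assumes "B \<in> (cyclic_tuples :: ((complex^'c::finite^'c)^'n::finite) set)"
  obtains \<beta> :: "'c::finite \<Rightarrow> 'n::finite monomial" where "inj \<beta>" "annihilator B \<in> hilb_chart (range \<beta>)"
proof -
  obtain v where B: "commuting_tuples B" and v: "cyclic_vector B v"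
    using assms unfolding cyclic_tuples_def by blast
  obtain \<beta> where "inj \<beta>" "det (frame_matrix B v \<beta>) \<noteq> 0"
    using v by (rule exists_frame)
  then show thesis
    using annihilator_in_chart_of_frame[OF B] that by blast
qed

text \<open>The construction of multiplication matrices applies to an arbitrary basis of the quotient. Its
  combination with \<open>cyclic_tuple_in_chart\<close> shows that there is also a basis of monomials, so that
  the charts cover the Hilbert scheme.\<close>
lemma hilb_point_is_annihilator:
  assumes "I \<in> hilb_points CARD('c::finite)"
  obtains B :: "(complex^'c::finite^'c)^'n::finite" where "B \<in> cyclic_tuples" "annihilator B = I"
proof -
  obtain E where E: "is_ideal I" "quotient_basis I E" "card E = CARD('c)"
    using assms unfolding hilb_points_def by blast
  then have "finite E" by (simp add: quotient_basis_def)
  then obtain \<beta> :: "'c \<Rightarrow> 'n cpoly" where \<beta>: "inj \<beta>" "range \<beta> = E"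
    using E(3) by (rule obtain_enumeration)
  then have basis: "quotient_basis I (range \<beta>)" using E(2) by simp
  show thesis
  proof (rule that)
    show "multiplication_matrices I \<beta> \<in> cyclic_tuples"
      using cyclic_vector_multiplication_matrices[OF E(1) \<beta>(1) basis]
        commuting_multiplication_matrices[OF E(1) \<beta>(1) basis]
      unfolding cyclic_tuples_def by blast
    show "annihilator (multiplication_matrices I \<beta>) = I"
      by (rule annihilator_multiplication_matrices[OF E(1) \<beta>(1) basis])
  qed
qed

lemma hilb_point_in_chart:
  assumes "I \<in> (hilb_points CARD('c::finite) :: 'n::finite cpoly set set)"
  obtains \<beta> :: "'c::finite \<Rightarrow> 'n::finite monomial" where "inj \<beta>" "I \<in> hilb_chart (range \<beta>)"
proof -
  obtain B :: "(complex^'c^'c)^'n" where "B \<in> cyclic_tuples" "annihilator B = I"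
    using assms by (rule hilb_point_is_annihilator)
  then show thesis
    using cyclic_tuple_in_chart[of B] that by blast
qed

lemma hilb_chart_openin:
  fixes \<beta> :: "'c::finite \<Rightarrow> 'n::finite monomial"
  assumes "inj \<beta>"
  shows "openin (hilbert_scheme CARD('c)) (hilb_chart (range \<beta>))"
  using chart_openin_hilbert_scheme[OF assms openin_topspace] by simp

lemma annihilator_image_cyclic_tuples:
  "annihilator ` (cyclic_tuples :: ((complex^'c::finite^'c)^'n::finite) set) = hilb_points CARD('c)"
proof
  show "annihilator ` (cyclic_tuples :: ((complex^'c^'c)^'n) set) \<subseteq> hilb_points CARD('c)"
  proof
    fix I assume "I \<in> annihilator ` (cyclic_tuples :: ((complex^'c^'c)^'n) set)"
    then obtain \<beta> :: "'c \<Rightarrow> 'n monomial" where "inj \<beta>" "I \<in> hilb_chart (range \<beta>)"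
      using cyclic_tuple_in_chart by blast
    then show "I \<in> hilb_points CARD('c)"
      using openin_subset[OF hilb_chart_openin] topspace_hilbert_scheme by blast
  qed
  show "hilb_points CARD('c) \<subseteq> annihilator ` (cyclic_tuples :: ((complex^'c^'c)^'n) set)"
    using hilb_point_is_annihilator by blast
qed

lemma openin_annihilator_preimage:
  fixes U :: "'n::finite cpoly set set"
  assumes U: "openin (hilbert_scheme CARD('c::finite)) U"
  shows "openin commuting_variety
    {B :: (complex^'c::finite^'c)^'n::finite. B \<in> cyclic_tuples \<and> annihilator B \<in> U}"
proof -
  let ?pre = "\<lambda>U. {B :: (complex^'c^'c)^'n. B \<in> cyclic_tuples \<and> annihilator B \<in> U}"
  have "?pre U = (\<Union>\<beta>\<in>{\<beta> :: 'c \<Rightarrow> 'n monomial. inj \<beta>}. ?pre (U \<inter> hilb_chart (range \<beta>)))"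
    using cyclic_tuple_in_chart by blast
  moreover have "openin (chart_topology (range \<beta>)) (U \<inter> hilb_chart (range \<beta>))"
    if "inj \<beta>" for \<beta> :: "'c \<Rightarrow> 'n monomial"
    using U that unfolding openin_hilbert_scheme by (simp add: card_image)
  then have "openin commuting_variety (?pre (U \<inter> hilb_chart (range \<beta>)))"
    if "inj \<beta>" for \<beta> :: "'c \<Rightarrow> 'n monomial"
    using that by (intro openin_annihilator_in_chart)
  ultimately show ?thesis
    by (metis (mono_tags, lifting) openin_Union imageE mem_Collect_eq)
qed

lemma openin_cyclic_tuples:
  "openin commuting_variety (cyclic_tuples :: ((complex^'c::finite^'c)^'n::finite) set)"
proof -
  have "{B :: (complex^'c^'c)^'n. B \<in> cyclic_tuples \<and> annihilator B \<in> hilb_points CARD('c)} = cyclic_tuples"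
    using annihilator_image_cyclic_tuples[where 'c = 'c and 'n = 'n] by blast
  then show ?thesis
    using openin_annihilator_preimage[OF openin_topspace, where 'c = 'c and 'n = 'n]
    by (simp add: topspace_hilbert_scheme)
qed

lemma continuous_map_annihilator:
  "continuous_map (subtopology commuting_variety (cyclic_tuples :: ((complex^'c::finite^'c)^'n::finite) set))
     (hilbert_scheme CARD('c)) annihilator"
proof -
  let ?A = "cyclic_tuples :: ((complex^'c^'c)^'n) set"
  have "topspace (subtopology commuting_variety ?A) = ?A"
    using openin_subset[OF openin_cyclic_tuples[where 'c = 'c and 'n = 'n]] by (simp add: Int_absorb1)
  then show ?thesis
    unfolding continuous_map_def topspace_hilbert_scheme
    using annihilator_image_cyclic_tuples[where 'c = 'c and 'n = 'n]
      openin_annihilator_preimage[where 'c = 'c and 'n = 'n]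
    by (auto simp: openin_open_subtopology[OF openin_cyclic_tuples])
qed

lemma continuous_map_chart_section:
  fixes \<beta> :: "'c::finite \<Rightarrow> 'n::finite monomial"
  assumes \<beta>: "inj \<beta>"
  shows "continuous_map (subtopology (hilbert_scheme CARD('c)) (hilb_chart (range \<beta>)))
    commuting_variety (\<lambda>I. multiplication_matrices I (monomial_poly \<circ> \<beta>))"
proof -
  let ?V = "hilb_chart (range \<beta>)"
  have "topspace (subtopology (hilbert_scheme CARD('c)) ?V) = ?V"
    using openin_subset[OF hilb_chart_openin[OF \<beta>]] by (simp add: Int_absorb1)
  moreover have "openin (hilbert_scheme CARD('c)) {I \<in> ?V. multiplication_matrices I (monomial_poly \<circ> \<beta>) \<in> T}"
    if "openin commuting_variety T" for T
    using chart_openin_hilbert_scheme[OF \<beta> openin_multiplication_matrices_preimage[OF that \<beta>]] .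
  ultimately show ?thesis
    unfolding continuous_map_def
    using multiplication_matrices_cyclic[OF _ \<beta>]
    by (auto simp: openin_open_subtopology[OF hilb_chart_openin[OF \<beta>]] topspace_commuting_variety cyclic_tuples_def)
qed

text \<open>The ideal of \<open>c\<close> distinct points on the diagonal, i.e. points all of whose coordinates are equal.
  The Lagrange interpolation polynomials in one of the variables form a basis of the quotient.\<close>
lemma hilb_points_nonempty: "(hilb_points CARD('c::finite) :: 'n::finite cpoly set set) \<noteq> {}"
proof -
  obtain t :: "'c \<Rightarrow> complex" where t: "inj t"
    using finite_imp_inj_to_nat_seg[of "UNIV :: 'c set"]
    by (metis finite inj_compose inj_of_nat)
  define pt :: "'c \<Rightarrow> 'n \<Rightarrow> complex" where "pt k = (\<lambda>_. t k)" for k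
  (* undefined stands for an arbitrarily chosen variable; on the diagonal all variables agree *)
  define X :: "'n cpoly" where "X = monomial_poly (Poly_Mapping.single undefined 1)"
  define L where "L k = (\<Prod>j\<in>UNIV - {k}. Poly_Mapping.single 0 (1 / (t k - t j)) *
      (X + Poly_Mapping.single 0 (- t j)))" for k
  have eval_prod: "eval_poly x (prod f A) = (\<Prod>a\<in>A. eval_poly x (f a))"
    for x and f :: "'c \<Rightarrow> 'n cpoly" and A
    by (induction A rule: infinite_finite_induct) (simp_all add: eval_poly_mult)
  have "eval_poly (pt l) X = t l" for l
    by (simp add: X_def pt_def monomial_poly_def eval_monomial_def)
  then have L: "eval_poly (pt l) (L k) = (\<Prod>j\<in>UNIV - {k}. (t l - t j) / (t k - t j))" for k l
    by (simp add: L_def eval_prod eval_poly_mult eval_poly_add)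
  have L_delta: "eval_poly (pt l) (L k) = (if l = k then 1 else 0)" for k l
  proof (cases "l = k")
    case True
    have "(t k - t j) / (t k - t j) = 1" if "j \<in> UNIV - {k}" for j
      using that t by (auto dest: injD)
    then show ?thesis
      by (simp add: L True)
  next
    case False
    then show ?thesis
      by (auto simp: L intro!: prod_zero bexI[of _ l])
  qed
  define I where "I = {p. \<forall>k. eval_poly (pt k) p = 0}"
  have "is_ideal I"
    by (simp add: is_ideal_iff I_def eval_poly_add eval_poly_mult)
  moreover have "inj L"
    by (rule injI) (metis L_delta zero_neq_one)
  moreover have "p - linear_combination L x \<in> I \<longleftrightarrow> x = (\<chi> k. eval_poly (pt k) p)" for p x
  proof -
    have "eval_poly (pt k) (linear_combination L x) = x $ k" for k
      by (simp add: linear_combination_def eval_poly_sum eval_poly_mult L_delta if_distrib cong: if_cong)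
    moreover have "eval_poly (pt k) (p - q) = 0 \<longleftrightarrow> eval_poly (pt k) p = eval_poly (pt k) q" for q k
      by (metis eval_poly_add diff_add_cancel add_cancel_left_left)
    ultimately show ?thesis
      by (auto simp: I_def vec_eq_iff)
  qed
  ultimately have "is_ideal I \<and> quotient_basis I (range L) \<and> card (range L) = CARD('c)"
    by (auto simp: quotient_basis_range_iff card_image)
  then show ?thesis
    unfolding hilb_points_def by blast
qed

theorem proposition6p1:
  shows "irreducible_components (hilbert_scheme CARD('c) :: 'n::finite cpoly set topology)
           \<lesssim> irreducible_components (commuting_variety :: ((complex^'c::finite^'c)^'n) topology)
         \<and> (irreducible_space (commuting_variety :: ((complex^'c^'c)^'n) topology)
           \<longrightarrow> irreducible_space (hilbert_scheme CARD('c) :: 'n cpoly set topology))"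
proof (intro conjI impI)
  show "irreducible_components (hilbert_scheme CARD('c) :: 'n cpoly set topology)
      \<lesssim> irreducible_components (commuting_variety :: ((complex^'c^'c)^'n) topology)"
  proof (rule irreducible_components_lepoll_of_local_sections[OF openin_cyclic_tuples
        continuous_map_annihilator])
    fix I :: "'n cpoly set"
    assume "I \<in> topspace (hilbert_scheme CARD('c))"
    then obtain \<beta> :: "'c \<Rightarrow> 'n monomial" where \<beta>: "inj \<beta>" "I \<in> hilb_chart (range \<beta>)"
      unfolding topspace_hilbert_scheme by (rule hilb_point_in_chart)
    then show "\<exists>V s. openin (hilbert_scheme CARD('c)) V \<and> I \<in> V \<and>
        continuous_map (subtopology (hilbert_scheme CARD('c)) V)
          (commuting_variety :: ((complex^'c^'c)^'n) topology) s \<and>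
        (\<forall>J\<in>V. s J \<in> cyclic_tuples \<and> annihilator (s J) = J)"
      using hilb_chart_openin[OF \<beta>(1)] continuous_map_chart_section[OF \<beta>(1)]
        multiplication_matrices_cyclic[OF _ \<beta>(1)] annihilator_chart_section[OF _ \<beta>(1)]
      by blast
  qed
next
  assume "irreducible_space (commuting_variety :: ((complex^'c^'c)^'n) topology)"
  then show "irreducible_space (hilbert_scheme CARD('c) :: 'n cpoly set topology)"
    by (rule irreducible_space_continuous_image[OF _ openin_cyclic_tuples continuous_map_annihilator])
       (simp_all only: annihilator_image_cyclic_tuples topspace_hilbert_scheme hilb_points_nonempty
         not_False_eq_True)
qed

end
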